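(* Let an oracle classification problem $(\mathcal F,\{A_j\}_{j\in\mathcal J},\{U_f\}_{f\in\mathcal F},\{p_f\}_{f\in\mathcal F})$ with $m$-qubit oracle unitaries $U_f$ be given, fix an integer $n\ge m$, and fix an $n$-qubit initial pure state $|\psi_0\rangle$. Consider all single-query quantum algorithms on $n$ qubits, i.e. all pairs $(V,W)$ of unitaries on $(\mathbb C^2)^{\otimes n}$, where the algorithm prepares $W(U_f\otimes I)V|\psi_0\rangle$ and measures all $n$ qubits in the computational basis with outcome $Y$. Then an algorithm $(V,W)$ attains the maximal value of the mutual information $I(J;Y)$ among all such algorithms if and only if both of the following conditions hold: (1) $I_{\max}(V|\psi_0\rangle)=\max_{|\psi_1\rangle} I_{\max}(|\psi_1\rangle)$, where the maximum is over all normalized $n$-qubit pure states $|\psi_1\rangle$; (2) $W^\dagger$ maps the computational basis to an orthonormal basis that yields the minimal discord for the post-query state, i.e. for the projective measurement $\Pi^W=\{W^\dagger|y\rangle\langle y|W\}_{y\in\{0,1\}^n}$ one has $$D_Y\bigl(\rho^2_{JY}(V|\psi_0\rangle);\Pi^W\bigr)=\min_{\Pi} D_Y\bigl(\rho^2_{JY}(V|\psi_0\rangle);\Pi\bigr),$$ where the minimum is over all projective measurements $\Pi$ on the $n$-qubit system.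
   Context: Oracle classification problem: a finite set $\mathcal F$ of oracle identities; a partition $\mathcal F=\bigsqcup_{j\in\mathcal J}A_j$ into nonempty classes; a unitary $U_f$ on $m$ qubits for each $f\in\mathcal F$; and a probability distribution $p_f=\Pr(F=f)$ on $\mathcal F$. The random variable $J$ is the class of $F$, i.e. the unique $j$ with $F\in A_j$; put $p_j=\sum_{f\in A_j}p_f$, assumed positive. Given $F=f$, the outcome $Y\in\{0,1\}^n$ has distribution $\Pr(Y=y\mid F=f)=|\langle y|W(U_f\otimes I)V|\psi_0\rangle|^2$, where $U_f$ acts on the first $m$ qubits and $I$ on the other $n-m$. $I(J;Y)$ is the Shannon mutual information of $J$ and $Y$. Logarithms are base 2. For a normalized $n$-qubit state $|\psi_1\rangle$ (the state just before the query), define $$\sigma_j^2=\sum_{f\in A_j}\frac{p_f}{p_j}(U_f\otimes I)|\psi_1\rangle\langle\psi_1|(U_f\otimes I)^\dagger,\qquad \rho^2_{JY}(|\psi_1\rangle)=\sum_{j\in\mathcal J}p_j|j\rangle\langle j|\otimes\sigma_j^2$$ on $\mathbb C^{\mathcal J}\otimes(\mathbb C^2)^{\otimes n}$, with $\{|j\rangle\}$ orthonormal (the superscript 2 is a label, not a square). $I_{\max}(|\psi_1\rangle)$ denotes the maximal $I(J;Y)$ obtainable over all choices of the post-query unitary $W$ when the pre-query state is $V|\psi_0\rangle=|\psi_1\rangle$. Non-optimized discord: for a bipartite state $\rho_{JY}$ with marginals $\rho_J,\rho_Y$ and a projective measurement $\Pi=\{\Pi_k\}_k$ on subsystem $Y$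 (orthogonal projections summing to the identity), $$D_Y(\rho_{JY};\Pi)=S(\rho_Y)-S(\rho_{JY})+S(\rho_J|\Pi),\qquad S(\rho_J|\Pi)=\sum_k q_k\,S(\rho_J^{k}),$$ where $q_k=\mathrm{Tr}[(I\otimes\Pi_k)\rho_{JY}]$, $\rho_J^k=\mathrm{Tr}_Y[(I\otimes\Pi_k)\rho_{JY}(I\otimes\Pi_k)]/q_k$ (terms with $q_k=0$ omitted), and $S$ is von Neumann entropy. *)

theory Defs
  imports
    "HOL-Probability.Information"
    "Jordan_Normal_Form.Schur_Decomposition"
begin

no_notation Finite_Cartesian_Product.vec_nth (infixl \<open>$\<close> 90)
hide_type (open) Finite_Cartesian_Product.vec

text \<open>
  The n-qubit space is the space of complex vectors of dimension \<open>2 ^ n\<close>. A bit string of length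
  n is identified with the number below \<open>2 ^ n\<close> that it denotes in binary, first qubit most
  significant; the computational basis vector of \<open>y\<close> is \<open>unit_vec (2 ^ n) y\<close>.
\<close>

definition normalized :: "nat \<Rightarrow> complex vec \<Rightarrow> bool" where
  "normalized N v \<longleftrightarrow> v \<in> carrier_vec N \<and> v \<bullet>c v = 1"

definition unitary_mat :: "nat \<Rightarrow> complex mat \<Rightarrow> bool" where
  "unitary_mat N U \<longleftrightarrow> U \<in> carrier_mat N N \<and>
     mat_adjoint U * U = 1\<^sub>m N \<and> U * mat_adjoint U = 1\<^sub>m N"

text \<open>Kronecker product; the left factor is the more significant index.\<close>

definition kron :: "complex mat \<Rightarrow> complex mat \<Rightarrow> complex mat" where
  "kron A B = mat (dim_row A * dim_row B) (dim_col A * dim_col B)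
     (\<lambda>(i, j). A $$ (i div dim_row B, j div dim_col B) * B $$ (i mod dim_row B, j mod dim_col B))"

definition ketbra :: "complex vec \<Rightarrow> complex mat" where
  "ketbra v = mat (dim_vec v) (dim_vec v) (\<lambda>(i, j). v $ i * cnj (v $ j))"

definition mat_sum :: "nat \<Rightarrow> ('i \<Rightarrow> complex mat) \<Rightarrow> 'i set \<Rightarrow> complex mat" where
  "mat_sum N M I = mat N N (\<lambda>ij. \<Sum>k\<in>I. M k $$ ij)"

definition mat_trace :: "complex mat \<Rightarrow> complex" where
  "mat_trace A = (\<Sum>i<dim_row A. A $$ (i, i))"

text \<open>Partial traces of an operator on the tensor product of spaces of dimensions \<open>d\<close> (subsystem J)
  and \<open>N\<close> (subsystem Y), indexed as in \<^const>\<open>kron\<close>.\<close>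

definition trace_out_Y :: "nat \<Rightarrow> nat \<Rightarrow> complex mat \<Rightarrow> complex mat" where
  "trace_out_Y d N R = mat d d (\<lambda>(i, j). \<Sum>k<N. R $$ (i * N + k, j * N + k))"

definition trace_out_J :: "nat \<Rightarrow> nat \<Rightarrow> complex mat \<Rightarrow> complex mat" where
  "trace_out_J d N R = mat N N (\<lambda>(k, l). \<Sum>i<d. R $$ (i * N + k, i * N + l))"

text \<open>Von Neumann entropy of a density operator, as the Shannon entropy of its eigenvalues counted
  with multiplicity. The convention \<open>0 log 0 = 0\<close> holds since \<open>0 * _ = 0\<close>.\<close>

definition vn_entropy :: "complex mat \<Rightarrow> real" where
  "vn_entropy R = - (\<Sum>e | eigenvalue R e.
     real (Polynomial.order e (char_poly R)) * (Re e * log 2 (Re e)))"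

text \<open>A finite family of mutually orthogonal orthogonal projections summing to the identity. The
  family is a list, so that the number of outcomes is not fixed and projections may have any rank.\<close>

definition projective_measurement :: "nat \<Rightarrow> complex mat list \<Rightarrow> bool" where
  "projective_measurement N Ps \<longleftrightarrow>
     (\<forall>P\<in>set Ps. P \<in> carrier_mat N N \<and> mat_adjoint P = P \<and> P * P = P) \<and>
     (\<forall>k<length Ps. \<forall>l<length Ps. k \<noteq> l \<longrightarrow> Ps ! k * Ps ! l = 0\<^sub>m N N) \<and>
     mat_sum N (\<lambda>k. Ps ! k) {..<length Ps} = 1\<^sub>m N"

definition outcome_weight :: "nat \<Rightarrow> complex mat \<Rightarrow> complex mat \<Rightarrow> real" where
  "outcome_weight d R P = Re (mat_trace (kron (1\<^sub>m d) P * R))"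

definition conditional_state :: "nat \<Rightarrow> nat \<Rightarrow> complex mat \<Rightarrow> complex mat \<Rightarrow> complex mat" where
  "conditional_state d N R P =
     complex_of_real (1 / outcome_weight d R P) \<cdot>\<^sub>m
       trace_out_Y d N (kron (1\<^sub>m d) P * R * kron (1\<^sub>m d) P)"

text \<open>Outcomes of weight zero contribute nothing, because of the factor \<open>outcome_weight d R P\<close>.\<close>

definition conditional_entropy_meas :: "nat \<Rightarrow> nat \<Rightarrow> complex mat \<Rightarrow> complex mat list \<Rightarrow> real" where
  "conditional_entropy_meas d N R Ps =
     (\<Sum>P\<leftarrow>Ps. outcome_weight d R P * vn_entropy (conditional_state d N R P))"

definition discord_Y :: "nat \<Rightarrow> nat \<Rightarrow> complex mat \<Rightarrow> complex mat list \<Rightarrow> real" where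
  "discord_Y d N R Ps =
     vn_entropy (trace_out_J d N R) - vn_entropy R + conditional_entropy_meas d N R Ps"

record ('f, 'j) oracle_problem =
  identities :: "'f set"
  labels :: "'j set"
  part :: "'j \<Rightarrow> 'f set"
  qubits :: nat
  query_gate :: "'f \<Rightarrow> complex mat"
  prior :: "'f \<Rightarrow> real"

definition label_prob :: "('f, 'j) oracle_problem \<Rightarrow> 'j \<Rightarrow> real" where
  "label_prob Q j = (\<Sum>f\<in>part Q j. prior Q f)"

definition label_of :: "('f, 'j) oracle_problem \<Rightarrow> 'f \<Rightarrow> 'j" where
  "label_of Q f = (THE j. j \<in> labels Q \<and> f \<in> part Q j)"

definition oracle_classification_problem :: "('f, 'j) oracle_problem \<Rightarrow> bool" where
  "oracle_classification_problem Q \<longleftrightarrow>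
     finite (identities Q) \<and>
     (\<Union>j\<in>labels Q. part Q j) = identities Q \<and>
     disjoint_family_on (part Q) (labels Q) \<and>
     (\<forall>j\<in>labels Q. part Q j \<noteq> {}) \<and>
     (\<forall>f\<in>identities Q. unitary_mat (2 ^ qubits Q) (query_gate Q f)) \<and>
     (\<forall>f\<in>identities Q. 0 \<le> prior Q f) \<and>
     (\<Sum>f\<in>identities Q. prior Q f) = 1 \<and>
     (\<forall>j\<in>labels Q. 0 < label_prob Q j)"

text \<open>The query unitary acting on the first \<open>qubits Q\<close> of \<open>n\<close> qubits.\<close>

definition query :: "('f, 'j) oracle_problem \<Rightarrow> nat \<Rightarrow> 'f \<Rightarrow> complex mat" where
  "query Q n f = kron (query_gate Q f) (1\<^sub>m (2 ^ (n - qubits Q)))"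

text \<open>The distribution of \<open>(F, Y)\<close> and the mutual information of \<open>J\<close> and \<open>Y\<close> when the pre-query
  state is \<open>\<psi>\<close> and the post-query unitary is \<open>W\<close>.\<close>

definition outcome_prob ::
    "('f, 'j) oracle_problem \<Rightarrow> nat \<Rightarrow> complex vec \<Rightarrow> complex mat \<Rightarrow> 'f \<Rightarrow> nat \<Rightarrow> real" where
  "outcome_prob Q n \<psi> W f y = (cmod ((W *\<^sub>v (query Q n f *\<^sub>v \<psi>)) $ y))\<^sup>2"

definition joint_distribution ::
    "('f, 'j) oracle_problem \<Rightarrow> nat \<Rightarrow> complex vec \<Rightarrow> complex mat \<Rightarrow> ('f \<times> nat) measure" where
  "joint_distribution Q n \<psi> W = point_measure (identities Q \<times> {..<2 ^ n})
     (\<lambda>(f, y). ennreal (prior Q f * outcome_prob Q n \<psi> W f y))"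

definition mutual_info ::
    "('f, 'j) oracle_problem \<Rightarrow> nat \<Rightarrow> complex vec \<Rightarrow> complex mat \<Rightarrow> real" where
  "mutual_info Q n \<psi> W =
     prob_space.mutual_information (joint_distribution Q n \<psi> W) 2
       (count_space (labels Q)) (count_space {..<2 ^ n}) (\<lambda>(f, y). label_of Q f) (\<lambda>(f, y). y)"

text \<open>The supremum is a maximum, since the unitary group is compact and \<open>mutual_info Q n \<psi>\<close> is
  continuous on it.\<close>

definition I_max :: "('f, 'j) oracle_problem \<Rightarrow> nat \<Rightarrow> complex vec \<Rightarrow> real" where
  "I_max Q n \<psi> = (SUP W\<in>{W. unitary_mat (2 ^ n) W}. mutual_info Q n \<psi> W)"

definition post_query_state ::
    "('f, 'j) oracle_problem \<Rightarrow> nat \<Rightarrow> complex vec \<Rightarrow> 'j \<Rightarrow> complex mat" where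
  "post_query_state Q n \<psi> j = mat_sum (2 ^ n)
     (\<lambda>f. complex_of_real (prior Q f / label_prob Q j) \<cdot>\<^sub>m
        (query Q n f * ketbra \<psi> * mat_adjoint (query Q n f))) (part Q j)"

text \<open>An orthonormal basis of the label register, indexed by the labels.\<close>

definition label_basis :: "('f, 'j) oracle_problem \<Rightarrow> ('j \<Rightarrow> complex vec) \<Rightarrow> bool" where
  "label_basis Q ket \<longleftrightarrow>
     (\<forall>j\<in>labels Q. ket j \<in> carrier_vec (card (labels Q))) \<and>
     (\<forall>i\<in>labels Q. \<forall>j\<in>labels Q. ket i \<bullet>c ket j = (if i = j then 1 else 0))"

definition rho_JY ::
    "('f, 'j) oracle_problem \<Rightarrow> ('j \<Rightarrow> complex vec) \<Rightarrow> nat \<Rightarrow> complex vec \<Rightarrow> complex mat" where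
  "rho_JY Q ket n \<psi> = mat_sum (card (labels Q) * 2 ^ n)
     (\<lambda>j. complex_of_real (label_prob Q j) \<cdot>\<^sub>m kron (ketbra (ket j)) (post_query_state Q n \<psi> j))
     (labels Q)"

definition basis_measurement :: "nat \<Rightarrow> complex mat \<Rightarrow> complex mat list" where
  "basis_measurement n W =
     map (\<lambda>y. mat_adjoint W * ketbra (unit_vec (2 ^ n) y) * W) [0..<2 ^ n]"

end

(*
  For a projection P write w_P(j) for the joint probability of the label j and the outcome P. For the
  classical-quantum state rho_JY the post-measurement states of J are diagonal in the label basis,
  so a measurement has discord const + sum_P H(w_P), with H the unnormalized Shannon entropy, while
  I(J;Y) = H(J) - sum_y H(w_y) for the rank-one measurement given by W. Hence for a fixed pre-query
  state the discord of the basis measurement and the mutual information have a constant sum.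
  Projections of higher rank do not help: every projective measurement is refined by a basis
  measurement, and H is superadditive by the log-sum inequality. Since unitaries act transitively on
  unit vectors, maximizing over V is maximizing over all pre-query states. Compactness is not
  needed: attainment of the maximum over W is part of either side of the equivalence.
*)
theory Submission
  imports Defs
begin

section \<open>Adjoints and unitary matrices\<close>

text \<open>\<open>vn_entropy\<close> is defined through roots of a characteristic polynomial, which
  is hard to evaluate for a general density operator. It is therefore evaluated only on conditional
  states of J, which the given label basis diagonalizes explicitly; S(rho_Y) and S(rho_JY) stay
  symbolic and cancel in every comparison. One construction serves two purposes: an orthonormal
  family is extended vector by vector, each new vector lying in the range of a single projection.
  For a given measurement this yields the refining basis; for the measurement with the single
  projection 1 it is ordinary completion to an orthonormal basis, from which transitivity on unit
  vectors follows. \<open>I_max\<close> is a real supremum, hence informative only for a bounded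
  set. The bound is H(J), uniform in the post-query unitary, and comes from nonnegativity of the
  unnormalized entropies.\<close>

lemma mat_adjoint_dim [simp]:
  "dim_row (mat_adjoint A) = dim_col A" "dim_col (mat_adjoint A) = dim_row A"
  by (simp_all add: mat_adjoint_def)

lemma mat_adjoint_index [simp]:
  "i < dim_col A \<Longrightarrow> j < dim_row A \<Longrightarrow> mat_adjoint A $$ (i, j) = cnj (A $$ (j, i))"
  by (simp add: mat_adjoint_def mat_of_rows_index)

lemma mat_adjoint_carrier [simp, intro]:
  "A \<in> carrier_mat r c \<Longrightarrow> mat_adjoint A \<in> carrier_mat c r"
  by (metis carrier_matD carrier_matI mat_adjoint_dim)

lemma mat_adjoint_adjoint [simp]: "mat_adjoint (mat_adjoint A) = (A :: complex mat)"
  by (rule eq_matI) auto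

lemma mat_adjoint_mult:
  assumes "A \<in> carrier_mat l m" "B \<in> carrier_mat m n"
  shows "mat_adjoint (A * B) = mat_adjoint B * (mat_adjoint A :: complex mat)"
  using assms by (intro eq_matI) (auto simp: scalar_prod_def mult.commute)

lemma mat_adjoint_one [simp]: "mat_adjoint (1\<^sub>m n) = (1\<^sub>m n :: complex mat)"
  by (rule eq_matI) auto

lemma unitary_matD:
  assumes "unitary_mat N U"
  shows "U \<in> carrier_mat N N" "mat_adjoint U * U = 1\<^sub>m N" "U * mat_adjoint U = 1\<^sub>m N"
  using assms by (auto simp: unitary_mat_def)

lemma unitary_mat_adjoint: "unitary_mat N U \<Longrightarrow> unitary_mat N (mat_adjoint U)"
  by (auto simp: unitary_mat_def)

lemma unitary_mat_mult:
  assumes "unitary_mat N A" "unitary_mat N B"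
  shows "unitary_mat N (A * B)"
proof -
  note A = unitary_matD[OF assms(1)] and B = unitary_matD[OF assms(2)]
  note A' = mat_adjoint_carrier[OF A(1)] and B' = mat_adjoint_carrier[OF B(1)]
  have "mat_adjoint B * mat_adjoint A * (A * B) = mat_adjoint B * (mat_adjoint A * (A * B))"
    by (rule assoc_mult_mat[OF B' A' mult_carrier_mat[OF A(1) B(1)]])
  also have "mat_adjoint A * (A * B) = mat_adjoint A * A * B"
    by (rule assoc_mult_mat[OF A' A(1) B(1), symmetric])
  finally have 1: "mat_adjoint B * mat_adjoint A * (A * B) = 1\<^sub>m N"
    using A B by simp
  have "A * B * (mat_adjoint B * mat_adjoint A) = A * (B * (mat_adjoint B * mat_adjoint A))"
    by (rule assoc_mult_mat[OF A(1) B(1) mult_carrier_mat[OF B' A']])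
  also have "B * (mat_adjoint B * mat_adjoint A) = B * mat_adjoint B * mat_adjoint A"
    by (rule assoc_mult_mat[OF B(1) B' A', symmetric])
  finally have "A * B * (mat_adjoint B * mat_adjoint A) = 1\<^sub>m N"
    using A B A' by simp
  with 1 show ?thesis
    using A B by (simp add: unitary_mat_def mat_adjoint_mult[OF A(1) B(1)])
qed

text \<open>The product \<open>\<bullet>c\<close> conjugates its second argument, so the inner
  product written <b|v> in bra-ket notation is \<open>v \<bullet>c b\<close> throughout.\<close>

lemma cscalar_prod_mult_mat_vec:
  assumes "(A :: complex mat) \<in> carrier_mat r c" "x \<in> carrier_vec c" "y \<in> carrier_vec r"
  shows "(A *\<^sub>v x) \<bullet>c y = x \<bullet>c (mat_adjoint A *\<^sub>v y)"
proof -
  have "(A *\<^sub>v x) \<bullet>c y = (\<Sum>i<r. \<Sum>k<c. A $$ (i, k) * x $ k * cnj (y $ i))"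
    using assms by (simp add: scalar_prod_def sum_distrib_right atLeast0LessThan)
  also have "\<dots> = (\<Sum>k<c. \<Sum>i<r. A $$ (i, k) * x $ k * cnj (y $ i))"
    by (rule sum.swap)
  also have "\<dots> = x \<bullet>c (mat_adjoint A *\<^sub>v y)"
    using assms by (simp add: scalar_prod_def sum_distrib_left atLeast0LessThan mult_ac)
  finally show ?thesis .
qed

lemma cscalar_prod_self: "v \<bullet>c v = complex_of_real (\<Sum>i<dim_vec v. (cmod (v $ i))\<^sup>2)"
  by (simp add: scalar_prod_def atLeast0LessThan complex_norm_square[symmetric])

lemma cnj_cscalar_prod:
  "dim_vec v = dim_vec w \<Longrightarrow> cnj (v \<bullet>c w) = w \<bullet>c (v :: complex vec)"
  by (simp add: scalar_prod_def mult.commute)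

lemma unitary_mat_normalized:
  assumes "unitary_mat N U" "normalized N v"
  shows "normalized N (U *\<^sub>v v)"
proof -
  note U = unitary_matD[OF assms(1)]
  have v: "v \<in> carrier_vec N" "v \<bullet>c v = 1"
    using assms(2) by (auto simp: normalized_def)
  have Uv: "U *\<^sub>v v \<in> carrier_vec N"
    using U(1) v(1) by (rule mult_mat_vec_carrier)
  have "(U *\<^sub>v v) \<bullet>c (U *\<^sub>v v) = v \<bullet>c (mat_adjoint U *\<^sub>v (U *\<^sub>v v))"
    by (rule cscalar_prod_mult_mat_vec[OF U(1) v(1) Uv])
  also have "mat_adjoint U *\<^sub>v (U *\<^sub>v v) = v"
    using assoc_mult_mat_vec[OF mat_adjoint_carrier[OF U(1)] U(1) v(1)] U(2) v(1) by simp
  finally show ?thesis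
    using v Uv by (simp add: normalized_def)
qed

section \<open>Kronecker products and traces\<close>

lemma kron_dim [simp]:
  "dim_row (kron A B) = dim_row A * dim_row B" "dim_col (kron A B) = dim_col A * dim_col B"
  by (simp_all add: kron_def)

lemma kron_carrier:
  "A \<in> carrier_mat a a \<Longrightarrow> B \<in> carrier_mat b b \<Longrightarrow> kron A B \<in> carrier_mat (a * b) (a * b)"
  by (metis carrier_matD carrier_matI kron_dim)

lemma kron_index [simp]:
  "i < dim_row A * dim_row B \<Longrightarrow> j < dim_col A * dim_col B \<Longrightarrow>
    kron A B $$ (i, j) = A $$ (i div dim_row B, j div dim_col B) * B $$ (i mod dim_row B, j mod dim_col B)"
  by (simp add: kron_def)

text \<open>Induction on the number of blocks: the indices from \<open>a * b\<close> up to
  \<open>a * b + b\<close> are those with quotient \<open>a\<close>. Every sum over a Kronecker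
  index becomes a double sum in this way.\<close>

lemma sum_div_mod:
  fixes a b :: nat
  shows "(\<Sum>k<a * b. f (k div b) (k mod b)) = (\<Sum>i<a. \<Sum>j<b. f i j)"
proof (induction a)
  case (Suc a)
  have "(\<Sum>k<a * b + b. f (k div b) (k mod b)) =
      (\<Sum>k<a * b. f (k div b) (k mod b)) + (\<Sum>k = 0 + a * b..<b + a * b. f (k div b) (k mod b))"
    by (simp add: lessThan_atLeast0 sum.atLeastLessThan_concat add.commute)
  also have "(\<Sum>k = 0 + a * b..<b + a * b. f (k div b) (k mod b)) = (\<Sum>j<b. f a j)"
    by (subst sum.shift_bounds_nat_ivl) (auto simp: lessThan_atLeast0 intro!: sum.cong)
  finally show ?case using Suc by (simp add: add.commute)
qed simp

lemma kron_mult: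
  assumes "A \<in> carrier_mat a a" "B \<in> carrier_mat b b" "C \<in> carrier_mat a a" "D \<in> carrier_mat b b"
  shows "kron A B * kron C D = kron (A * C) (B * D)"
proof (rule eq_matI)
  fix i j assume "i < dim_row (kron (A * C) (B * D))" "j < dim_col (kron (A * C) (B * D))"
  then have ij: "i < a * b" "j < a * b" using assms by auto
  then have b: "0 < b" by (cases b) auto
  have dm: "i div b < a" "j div b < a" "i mod b < b" "j mod b < b"
    using ij b by (auto simp: less_mult_imp_div_less)
  have "(kron A B * kron C D) $$ (i, j) =
    (\<Sum>k<a * b. A $$ (i div b, k div b) * B $$ (i mod b, k mod b) * (C $$ (k div b, j div b) * D $$ (k mod b, j mod b)))"
    using assms ij by (simp add: scalar_prod_def atLeast0LessThan)
  also have "\<dots> = (\<Sum>k<a. \<Sum>l<b. A $$ (i div b, k) * B $$ (i mod b, l) * (C $$ (k, j div b) * D $$ (l, j mod b)))"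
    by (rule sum_div_mod)
  also have "\<dots> = kron (A * C) (B * D) $$ (i, j)"
    using assms ij dm by (simp add: scalar_prod_def atLeast0LessThan sum_product mult_ac)
  finally show "(kron A B * kron C D) $$ (i, j) = kron (A * C) (B * D) $$ (i, j)" .
qed (use assms in auto)

lemma kron_adjoint: "mat_adjoint (kron A B) = kron (mat_adjoint A) (mat_adjoint B)"
proof (rule eq_matI)
  fix i j assume "i < dim_row (kron (mat_adjoint A) (mat_adjoint B))"
    "j < dim_col (kron (mat_adjoint A) (mat_adjoint B))"
  then have ij: "i < dim_col A * dim_col B" "j < dim_row A * dim_row B" by auto
  then have "0 < dim_col B" "0 < dim_row B" by (auto intro: gr0I)
  then show "mat_adjoint (kron A B) $$ (i, j) = kron (mat_adjoint A) (mat_adjoint B) $$ (i, j)"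
    using ij by (auto simp: less_mult_imp_div_less)
qed auto

lemma kron_one: "kron (1\<^sub>m a) (1\<^sub>m b) = 1\<^sub>m (a * b)"
proof (rule eq_matI)
  fix i j assume "i < dim_row (1\<^sub>m (a * b) :: complex mat)" "j < dim_col (1\<^sub>m (a * b) :: complex mat)"
  then have ij: "i < a * b" "j < a * b" by auto
  then have b: "0 < b" by (cases b) auto
  have "i = j \<longleftrightarrow> i div b = j div b \<and> i mod b = j mod b"
    by (metis div_mult_mod_eq)
  then show "kron (1\<^sub>m a) (1\<^sub>m b) $$ (i, j) = 1\<^sub>m (a * b) $$ (i, j)"
    using ij b by (auto simp: less_mult_imp_div_less)
qed auto

lemma kron_unitary:
  assumes "unitary_mat a A" "unitary_mat b B"
  shows "unitary_mat (a * b) (kron A B)"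
  using assms unfolding unitary_mat_def
  by (auto simp: kron_adjoint kron_one kron_carrier kron_mult[of _ a _ b])

lemma mat_trace_mult_commute:
  assumes "A \<in> carrier_mat N N" "B \<in> carrier_mat N N"
  shows "mat_trace (A * B) = mat_trace (B * A)"
proof -
  have "mat_trace (A * B) = (\<Sum>i<N. \<Sum>k<N. A $$ (i, k) * B $$ (k, i))"
    using assms by (simp add: mat_trace_def scalar_prod_def atLeast0LessThan)
  also have "\<dots> = (\<Sum>k<N. \<Sum>i<N. A $$ (i, k) * B $$ (k, i))" by (rule sum.swap)
  also have "\<dots> = mat_trace (B * A)"
    using assms by (simp add: mat_trace_def scalar_prod_def atLeast0LessThan mult.commute)
  finally show ?thesis .
qed

lemma mat_trace_kron:
  assumes "A \<in> carrier_mat a a" "B \<in> carrier_mat b b"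
  shows "mat_trace (kron A B) = mat_trace A * mat_trace B"
proof -
  have "mat_trace (kron A B) = (\<Sum>k<a * b. A $$ (k div b, k div b) * B $$ (k mod b, k mod b))"
    using assms by (simp add: mat_trace_def)
  also have "\<dots> = (\<Sum>i<a. \<Sum>j<b. A $$ (i, i) * B $$ (j, j))" by (rule sum_div_mod)
  finally show ?thesis using assms by (simp add: mat_trace_def sum_product)
qed

section \<open>Finite sums of matrices, their products and traces\<close>

lemma mat_sum_dim [simp]: "dim_row (mat_sum N M I) = N" "dim_col (mat_sum N M I) = N"
  by (simp_all add: mat_sum_def)

lemma mat_sum_carrier [simp]: "mat_sum N M I \<in> carrier_mat N N"
  by (simp add: mat_sum_def)

lemma mat_sum_index [simp]: "i < N \<Longrightarrow> j < N \<Longrightarrow> mat_sum N M I $$ (i, j) = (\<Sum>k\<in>I. M k $$ (i, j))"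
  by (simp add: mat_sum_def)

lemma mat_sum_cong: "(\<And>k. k \<in> I \<Longrightarrow> M k = M' k) \<Longrightarrow> mat_sum N M I = mat_sum N M' I"
  by (simp add: mat_sum_def cong: sum.cong)

lemma mat_sum_mult_left:
  assumes "A \<in> carrier_mat N N" "\<And>k. k \<in> I \<Longrightarrow> M k \<in> carrier_mat N N"
  shows "A * mat_sum N M I = mat_sum N (\<lambda>k. A * M k) I"
proof (rule eq_matI)
  fix i j assume "i < dim_row (mat_sum N (\<lambda>k. A * M k) I)" "j < dim_col (mat_sum N (\<lambda>k. A * M k) I)"
  then have ij: "i < N" "j < N" by auto
  have "(A * mat_sum N M I) $$ (i, j) = (\<Sum>l<N. \<Sum>k\<in>I. A $$ (i, l) * M k $$ (l, j))"
    using assms(1) ij by (simp add: scalar_prod_def atLeast0LessThan sum_distrib_left)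
  also have "\<dots> = (\<Sum>k\<in>I. \<Sum>l<N. A $$ (i, l) * M k $$ (l, j))" by (rule sum.swap)
  also have "\<dots> = (\<Sum>k\<in>I. (A * M k) $$ (i, j))"
    using assms ij by (intro sum.cong) (auto simp: scalar_prod_def atLeast0LessThan dest!: assms(2))
  finally show "(A * mat_sum N M I) $$ (i, j) = mat_sum N (\<lambda>k. A * M k) I $$ (i, j)"
    using ij by simp
qed (use assms in auto)

lemma mat_sum_mult_right:
  assumes "A \<in> carrier_mat N N" "\<And>k. k \<in> I \<Longrightarrow> M k \<in> carrier_mat N N"
  shows "mat_sum N M I * A = mat_sum N (\<lambda>k. M k * A) I"
proof (rule eq_matI)
  fix i j assume "i < dim_row (mat_sum N (\<lambda>k. M k * A) I)" "j < dim_col (mat_sum N (\<lambda>k. M k * A) I)"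
  then have ij: "i < N" "j < N" by auto
  have "(mat_sum N M I * A) $$ (i, j) = (\<Sum>l<N. \<Sum>k\<in>I. M k $$ (i, l) * A $$ (l, j))"
    using assms(1) ij by (simp add: scalar_prod_def atLeast0LessThan sum_distrib_right)
  also have "\<dots> = (\<Sum>k\<in>I. \<Sum>l<N. M k $$ (i, l) * A $$ (l, j))" by (rule sum.swap)
  also have "\<dots> = (\<Sum>k\<in>I. (M k * A) $$ (i, j))"
    using assms ij by (intro sum.cong) (auto simp: scalar_prod_def atLeast0LessThan dest!: assms(2))
  finally show "(mat_sum N M I * A) $$ (i, j) = mat_sum N (\<lambda>k. M k * A) I $$ (i, j)"
    using ij by simp
qed (use assms in auto)

lemma mat_trace_mat_sum:
  assumes "\<And>k. k \<in> I \<Longrightarrow> M k \<in> carrier_mat N N"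
  shows "mat_trace (mat_sum N M I) = (\<Sum>k\<in>I. mat_trace (M k))"
proof -
  have "mat_trace (mat_sum N M I) = (\<Sum>k\<in>I. \<Sum>i<N. M k $$ (i, i))"
    by (simp add: mat_trace_def sum.swap[of _ I])
  also have "\<dots> = (\<Sum>k\<in>I. mat_trace (M k))"
    using assms by (intro sum.cong) (auto simp: mat_trace_def dest: carrier_matD)
  finally show ?thesis .
qed

lemma mat_trace_smult: "A \<in> carrier_mat N N \<Longrightarrow> mat_trace (c \<cdot>\<^sub>m A) = c * mat_trace A"
  by (simp add: mat_trace_def sum_distrib_left)

text \<open>Tracing out Y turns each A \<otimes> B into Tr(B) A. The lemma is stated for sums of
  scaled tensor products because \<open>rho_JY\<close> and its post-measurement versions all have
  this shape.\<close>

lemma trace_out_Y_mat_sum_kron: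
  assumes A: "\<And>j. j \<in> I \<Longrightarrow> A j \<in> carrier_mat d d" and B: "\<And>j. j \<in> I \<Longrightarrow> B j \<in> carrier_mat N N"
  shows "trace_out_Y d N (mat_sum (d * N) (\<lambda>j. c j \<cdot>\<^sub>m kron (A j) (B j)) I) =
    mat_sum d (\<lambda>j. (c j * mat_trace (B j)) \<cdot>\<^sub>m A j) I"
proof (rule eq_matI)
  fix i l assume "i < dim_row (mat_sum d (\<lambda>j. (c j * mat_trace (B j)) \<cdot>\<^sub>m A j) I)"
    "l < dim_col (mat_sum d (\<lambda>j. (c j * mat_trace (B j)) \<cdot>\<^sub>m A j) I)"
  then have il: "i < d" "l < d" by auto
  have lt: "i * N + k < d * N" "l * N + k < d * N" if "k < N" for k
  proof -
    have "i * N + k < Suc i * N" "l * N + k < Suc l * N" using that by auto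
    moreover have "Suc i * N \<le> d * N" "Suc l * N \<le> d * N"
      using il by (simp_all only: mult_le_mono1 Suc_leI)
    ultimately show "i * N + k < d * N" "l * N + k < d * N" by linarith+
  qed
  have "trace_out_Y d N (mat_sum (d * N) (\<lambda>j. c j \<cdot>\<^sub>m kron (A j) (B j)) I) $$ (i, l) =
     (\<Sum>k<N. \<Sum>j\<in>I. c j * (A j $$ (i, l) * B j $$ (k, k)))"
    unfolding trace_out_Y_def using il lt
    by (auto intro!: sum.cong simp: carrier_matD[OF A] carrier_matD[OF B])
  also have "\<dots> = (\<Sum>j\<in>I. \<Sum>k<N. c j * (A j $$ (i, l) * B j $$ (k, k)))" by (rule sum.swap)
  also have "\<dots> = mat_sum d (\<lambda>j. (c j * mat_trace (B j)) \<cdot>\<^sub>m A j) I $$ (i, l)"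
    using il by (auto intro!: sum.cong simp: carrier_matD[OF A] carrier_matD[OF B] mat_trace_def
      sum_distrib_left sum_distrib_right mult_ac)
  finally show "trace_out_Y d N (mat_sum (d * N) (\<lambda>j. c j \<cdot>\<^sub>m kron (A j) (B j)) I) $$ (i, l) =
    mat_sum d (\<lambda>j. (c j * mat_trace (B j)) \<cdot>\<^sub>m A j) I $$ (i, l)" .
qed (auto simp: trace_out_Y_def)

section \<open>Orthonormal bases adapted to a projective measurement\<close>

definition orthonormal :: "nat \<Rightarrow> complex vec list \<Rightarrow> bool" where
  "orthonormal N bs \<longleftrightarrow> set bs \<subseteq> carrier_vec N \<and>
     (\<forall>i<length bs. \<forall>j<length bs. bs ! i \<bullet>c bs ! j = (if i = j then 1 else 0))"

lemma orthonormal_unitary_mat: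
  assumes "orthonormal N bs" "length bs = N"
  shows "unitary_mat N (mat_of_cols N bs)"
proof -
  let ?B = "mat_of_cols N bs"
  have B: "?B \<in> carrier_mat N N" using assms(2) by auto
  have BB: "mat_adjoint ?B * ?B = 1\<^sub>m N"
  proof (rule eq_matI)
    fix i j assume "i < dim_row (1\<^sub>m N :: complex mat)" "j < dim_col (1\<^sub>m N :: complex mat)"
    then have ij: "i < N" "j < N" by auto
    then have "bs ! i \<in> carrier_vec N" "bs ! j \<in> carrier_vec N"
      using assms by (auto simp: orthonormal_def)
    then have "(mat_adjoint ?B * ?B) $$ (i, j) = bs ! j \<bullet>c bs ! i"
      using ij assms(2) by (simp add: scalar_prod_def mat_of_cols_index mult.commute)
    then show "(mat_adjoint ?B * ?B) $$ (i, j) = 1\<^sub>m N $$ (i, j)"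
      using ij assms by (auto simp: orthonormal_def)
  qed (use assms in auto)
  \<comment> \<open>For square matrices a left inverse is also a right inverse; this gives
    completeness of the basis from its orthonormality.\<close>
  moreover have "?B * mat_adjoint ?B = 1\<^sub>m N"
    by (rule mat_mult_left_right_inverse[OF mat_adjoint_carrier[OF B] B BB])
  ultimately show ?thesis using B by (simp add: unitary_mat_def)
qed

text \<open>Dimension count by determinants: the conjugated vectors, padded with zero rows, form a
  singular square matrix, and any nonzero kernel vector is orthogonal to all of them.\<close>

lemma exists_orthogonal_vec:
  assumes "set bs \<subseteq> carrier_vec N" "length bs < N"
  obtains v :: "complex vec" where "v \<in> carrier_vec N" "v \<noteq> 0\<^sub>v N" "\<And>b. b \<in> set bs \<Longrightarrow> v \<bullet>c b = 0"
proof -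
  \<comment> \<open>Row \<open>N - 1\<close> is free because \<open>length bs < N\<close>. It is
    singled out by a separate case to match the form of \<open>det_row_0\<close>.\<close>
  define A where "A = mat\<^sub>r N N (\<lambda>i. if i = N - 1 then 0\<^sub>v N else if i < length bs then conjugate (bs ! i) else 0\<^sub>v N)"
  have c: "conjugate (bs ! i) \<in> carrier_vec N" if "i < length bs" for i
    using nth_mem[OF that] assms(1) by auto
  have "det A = 0"
    unfolding A_def using assms(2) c by (intro det_row_0) auto
  moreover have A: "A \<in> carrier_mat N N" by (simp add: A_def)
  ultimately obtain v where v: "v \<in> carrier_vec N" "v \<noteq> 0\<^sub>v N" "A *\<^sub>v v = 0\<^sub>v N"
    using det_0_iff_vec_prod_zero[OF A] by auto
  have "v \<bullet>c (bs ! i) = 0" if i: "i < length bs" for i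
  proof -
    have "(A *\<^sub>v v) $ i = conjugate (bs ! i) \<bullet> v"
      using i assms(2) c[OF i] A by (simp add: A_def row_mat_of_row_fun)
    also have "\<dots> = v \<bullet>c (bs ! i)"
      using v(1) c[OF i] by (rule comm_scalar_prod[rotated])
    finally show ?thesis using v(3) i assms(2) by simp
  qed
  then show ?thesis using that v by (metis in_set_conv_nth)
qed

lemma projective_measurementD:
  assumes "projective_measurement N Ps" "k < length Ps"
  shows "Ps ! k \<in> carrier_mat N N" "mat_adjoint (Ps ! k) = Ps ! k" "Ps ! k * Ps ! k = Ps ! k"
    "l < length Ps \<Longrightarrow> k \<noteq> l \<Longrightarrow> Ps ! k * Ps ! l = 0\<^sub>m N N"
  using assms by (auto simp: projective_measurement_def)

lemma zero_mat_mult_vec: "v \<in> carrier_vec c \<Longrightarrow> 0\<^sub>m r c *\<^sub>v v = 0\<^sub>v r"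
  by (rule eq_vecI) auto

lemma projective_measurement_vec:
  assumes Ps: "projective_measurement N Ps" and k: "k < length Ps" and b: "b \<in> carrier_vec N"
  shows "Ps ! k *\<^sub>v (Ps ! k *\<^sub>v b) = Ps ! k *\<^sub>v b"
    and "l < length Ps \<Longrightarrow> k \<noteq> l \<Longrightarrow> Ps ! l *\<^sub>v (Ps ! k *\<^sub>v b) = 0\<^sub>v N"
proof -
  note P = projective_measurementD[OF Ps]
  show "Ps ! k *\<^sub>v (Ps ! k *\<^sub>v b) = Ps ! k *\<^sub>v b"
    using assoc_mult_mat_vec[OF P(1)[OF k] P(1)[OF k] b] P(3)[OF k] by simp
  assume l: "l < length Ps" "k \<noteq> l"
  show "Ps ! l *\<^sub>v (Ps ! k *\<^sub>v b) = 0\<^sub>v N"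
    using assoc_mult_mat_vec[OF P(1)[OF l(1)] P(1)[OF k] b] P(4)[OF l(1) k] l(2) b
    by (metis zero_mat_mult_vec)
qed

text \<open>Completeness gives v as the sum of its components \<open>Ps ! k *\<^sub>v v\<close>, so
  a nonzero v has a nonzero component.\<close>

lemma projective_measurement_eq_0:
  assumes Ps: "projective_measurement N Ps" and v: "v \<in> carrier_vec N"
    and 0: "\<And>k. k < length Ps \<Longrightarrow> Ps ! k *\<^sub>v v = 0\<^sub>v N"
  shows "v = 0\<^sub>v N"
proof (rule eq_vecI)
  fix i assume "i < dim_vec (0\<^sub>v N :: complex vec)"
  then have i: "i < N" by simp
  have P: "Ps ! k \<in> carrier_mat N N" if "k < length Ps" for k
    using projective_measurementD(1)[OF Ps that] .
  have "v $ i = (mat_sum N (\<lambda>k. Ps ! k) {..<length Ps} *\<^sub>v v) $ i"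
    using Ps v by (simp add: projective_measurement_def)
  also have "\<dots> = (\<Sum>j<N. \<Sum>k<length Ps. Ps ! k $$ (i, j) * v $ j)"
    using i v by (simp add: scalar_prod_def atLeast0LessThan sum_distrib_right)
  also have "\<dots> = (\<Sum>k<length Ps. \<Sum>j<N. Ps ! k $$ (i, j) * v $ j)" by (rule sum.swap)
  also have "\<dots> = (\<Sum>k<length Ps. (Ps ! k *\<^sub>v v) $ i)"
    using i v by (intro sum.cong) (auto simp: scalar_prod_def atLeast0LessThan dest!: P)
  also have "\<dots> = 0" using 0 i by simp
  finally show "v $ i = 0\<^sub>v N $ i" using i by simp
qed (use v in auto)

lemma orthonormal_snoc:
  assumes "orthonormal N bs" "v \<in> carrier_vec N" "v \<bullet>c v = 1" "\<And>b. b \<in> set bs \<Longrightarrow> v \<bullet>c b = 0"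
  shows "orthonormal N (bs @ [v])"
proof -
  have "b \<bullet>c v = 0" if "b \<in> set bs" for b
  proof -
    have "b \<in> carrier_vec N" using assms(1) that by (auto simp: orthonormal_def)
    then show ?thesis
      using cnj_cscalar_prod[of v b] assms(2) assms(4)[OF that] by simp
  qed
  then show ?thesis
    using assms unfolding orthonormal_def by (auto simp: nth_append less_Suc_eq)
qed

lemma normalize_vec:
  assumes "v \<in> carrier_vec N" "v \<noteq> 0\<^sub>v N"
  obtains c :: complex where "(c \<cdot>\<^sub>v v) \<bullet>c (c \<cdot>\<^sub>v v) = 1"
proof -
  define r where "r = (\<Sum>i<N. (cmod (v $ i))\<^sup>2)"
  have r: "v \<bullet>c v = complex_of_real r" using assms(1) by (simp add: cscalar_prod_self r_def)
  have "r \<noteq> 0" using conjugate_square_eq_0_vec[OF assms(1)] assms(2) r by auto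
  moreover have "0 \<le> r" by (simp add: r_def sum_nonneg)
  ultimately have "0 < r" by simp
  let ?c = "complex_of_real (1 / sqrt r)"
  have "(?c \<cdot>\<^sub>v v) \<bullet>c (?c \<cdot>\<^sub>v v) = ?c * ?c * (v \<bullet>c v)"
    using assms(1) by (simp add: conjugate_smult_vec)
  also have "\<dots> = 1"
    using \<open>0 < r\<close> unfolding r by (simp flip: of_real_mult add: field_simps)
  finally show ?thesis by (rule that)
qed

text \<open>The vector lies in the range of one projection. Orthogonality of the family makes the
  others annihilate it, so a basis of adapted vectors diagonalizes all projections at once.\<close>

definition adapted :: "complex mat list \<Rightarrow> complex vec \<Rightarrow> bool" where
  "adapted Ps b \<longleftrightarrow> (\<exists>k<length Ps. Ps ! k *\<^sub>v b = b)"

text \<open>If the family is not complete, some vector \<open>v \<noteq> 0\<close> is orthogonal to it, and so is each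
  \<open>Ps ! k *\<^sub>v v\<close>, because the members of the family are adapted; one of these is nonzero.\<close>

lemma orthonormal_extend:
  assumes "projective_measurement N Ps" "orthonormal N bs" "length bs \<le> N" "\<forall>b\<in>set bs. adapted Ps b"
  shows "\<exists>cs. orthonormal N (bs @ cs) \<and> length (bs @ cs) = N \<and> (\<forall>b\<in>set (bs @ cs). adapted Ps b)"
  using assms(2-)
proof (induction "N - length bs" arbitrary: bs)
  case 0
  then show ?case by (intro exI[of _ "[]"]) auto
next
  case (Suc x)
  note P = projective_measurementD[OF assms(1)]
  have len: "length bs < N" and sub: "set bs \<subseteq> carrier_vec N"
    using Suc.hyps(2) Suc.prems by (auto simp: orthonormal_def)
  obtain v where v: "v \<in> carrier_vec N" "v \<noteq> 0\<^sub>v N" "\<And>b. b \<in> set bs \<Longrightarrow> v \<bullet>c b = 0"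
    using exists_orthogonal_vec[OF sub len] by blast
  obtain k where k: "k < length Ps" "Ps ! k *\<^sub>v v \<noteq> 0\<^sub>v N"
    using projective_measurement_eq_0[OF assms(1) v(1)] v(2) by blast
  define u where "u = Ps ! k *\<^sub>v v"
  have u: "u \<in> carrier_vec N" unfolding u_def using P(1)[OF k(1)] v(1) by (rule mult_mat_vec_carrier)
  obtain c where c: "(c \<cdot>\<^sub>v u) \<bullet>c (c \<cdot>\<^sub>v u) = 1"
    using normalize_vec[OF u] k(2) u_def by metis
  have orth: "(c \<cdot>\<^sub>v u) \<bullet>c b = 0" if b: "b \<in> set bs" for b
  proof -
    have bc: "b \<in> carrier_vec N" using b sub by auto
    obtain l where l: "l < length Ps" "Ps ! l *\<^sub>v b = b"
      using Suc.prems(3) b by (auto simp: adapted_def)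
    \<comment> \<open>Self-adjointness moves the projection over to \<open>b\<close>, on which it
      acts as the identity if \<open>k = l\<close> and as zero otherwise.\<close>
    have "u \<bullet>c b = v \<bullet>c (Ps ! k *\<^sub>v b)"
      unfolding u_def using cscalar_prod_mult_mat_vec[OF P(1)[OF k(1)] v(1) bc] P(2)[OF k(1)] by simp
    also have "\<dots> = 0"
    proof (cases "k = l")
      case True
      then show ?thesis using l v(3)[OF b] by simp
    next
      case False
      then have "Ps ! k *\<^sub>v b = 0\<^sub>v N"
        using projective_measurement_vec(2)[OF assms(1) l(1) bc k(1)] l(2) by auto
      then show ?thesis using v(1) by simp
    qed
    finally show ?thesis using u bc by simp
  qed
  have "Ps ! k *\<^sub>v (c \<cdot>\<^sub>v u) = c \<cdot>\<^sub>v u"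
    using mult_mat_vec[OF P(1)[OF k(1)] u, of c] projective_measurement_vec(1)[OF assms(1) k(1) v(1)]
    by (simp add: u_def)
  then have "adapted Ps (c \<cdot>\<^sub>v u)" using k(1) by (auto simp: adapted_def)
  moreover have "orthonormal N (bs @ [c \<cdot>\<^sub>v u])"
    using Suc.prems(1) u c orth by (intro orthonormal_snoc) auto
  moreover have "x = N - length (bs @ [c \<cdot>\<^sub>v u])" using Suc.hyps(2) by simp
  ultimately obtain cs where "orthonormal N ((bs @ [c \<cdot>\<^sub>v u]) @ cs)" "length ((bs @ [c \<cdot>\<^sub>v u]) @ cs) = N"
    "\<forall>b\<in>set ((bs @ [c \<cdot>\<^sub>v u]) @ cs). adapted Ps b"
    using Suc.hyps(1)[of "bs @ [c \<cdot>\<^sub>v u]"] Suc.prems len by auto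
  then show ?case by (intro exI[of _ "(c \<cdot>\<^sub>v u) # cs"]) simp
qed

text \<open>Every vector of dimension \<open>N\<close> is adapted to this measurement, so
  \<open>orthonormal_extend\<close> specializes to ordinary completion to an orthonormal
  basis.\<close>

lemma projective_measurement_one: "projective_measurement N [1\<^sub>m N]"
proof -
  have "mat_sum N (\<lambda>k. [1\<^sub>m N] ! k) {..<length [1\<^sub>m N]} = 1\<^sub>m N"
    by (rule eq_matI) auto
  then show ?thesis by (auto simp: projective_measurement_def)
qed

lemma normalized_orthonormal_basis:
  assumes "normalized N a" "0 < N"
  obtains U where "unitary_mat N U" "col U 0 = a"
proof -
  have a: "a \<in> carrier_vec N" "a \<bullet>c a = 1" using assms by (auto simp: normalized_def)
  then have "orthonormal N [a]" "\<forall>b\<in>set [a]. adapted [1\<^sub>m N] b"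
    by (auto simp: orthonormal_def adapted_def)
  then obtain cs where "orthonormal N (a # cs)" "length (a # cs) = N"
    using orthonormal_extend[OF projective_measurement_one, of N "[a]"] assms(2) by auto
  moreover from this have "col (mat_of_cols N (a # cs)) 0 = a"
    using a by (subst col_mat_of_cols) auto
  ultimately show ?thesis using that orthonormal_unitary_mat by blast
qed

text \<open>With unitaries A and B whose first columns are a and b, the adjoint of A sends a to the
  first basis vector and B sends that to b, so U is B times the adjoint of A.\<close>

lemma unitary_mat_transitive:
  assumes "normalized N a" "normalized N b" "0 < N"
  obtains U where "unitary_mat N U" "U *\<^sub>v a = b"
proof -
  obtain A where A: "unitary_mat N A" "col A 0 = a"
    using normalized_orthonormal_basis[OF assms(1,3)] .
  obtain B where B: "unitary_mat N B" "col B 0 = b"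
    using normalized_orthonormal_basis[OF assms(2,3)] .
  note A' = unitary_matD[OF A(1)] and B' = unitary_matD[OF B(1)]
  have a: "a \<in> carrier_vec N" using assms(1) by (simp add: normalized_def)
  have "mat_adjoint A *\<^sub>v a = col (mat_adjoint A * A) 0"
    using A'(1) A(2) assms(3) by (subst col_mult2[of _ N N _ N]) auto
  then have "B *\<^sub>v (mat_adjoint A *\<^sub>v a) = B *\<^sub>v col (1\<^sub>m N) 0"
    by (simp add: A'(2))
  also have "\<dots> = col (B * 1\<^sub>m N) 0"
    using B'(1) assms(3) by (subst col_mult2[of _ N N _ N]) auto
  also have "\<dots> = b" using B'(1) B(2) by simp
  finally have "(B * mat_adjoint A) *\<^sub>v a = b"
    using assoc_mult_mat_vec[OF B'(1) mat_adjoint_carrier[OF A'(1)] a] by simp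
  then show ?thesis
    using that unitary_mat_mult[OF B(1) unitary_mat_adjoint[OF A(1)]] by blast
qed

section \<open>Rank-one projections and basis measurements\<close>

lemma ketbra_dim [simp]: "dim_row (ketbra v) = dim_vec v" "dim_col (ketbra v) = dim_vec v"
  by (simp_all add: ketbra_def)

lemma ketbra_index [simp]:
  "i < dim_vec v \<Longrightarrow> j < dim_vec v \<Longrightarrow> ketbra v $$ (i, j) = v $ i * cnj (v $ j)"
  by (simp add: ketbra_def)

lemma ketbra_carrier [simp]: "v \<in> carrier_vec N \<Longrightarrow> ketbra v \<in> carrier_mat N N"
  by (auto simp: ketbra_def)

lemma ketbra_conjugate:
  assumes "A \<in> carrier_mat N N" "v \<in> carrier_vec N"
  shows "A * ketbra v * mat_adjoint A = ketbra (A *\<^sub>v v)"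
proof (rule eq_matI)
  fix i j assume "i < dim_row (ketbra (A *\<^sub>v v))" "j < dim_col (ketbra (A *\<^sub>v v))"
  then have "i < N" "j < N" using assms by (auto simp: ketbra_def)
  then show "(A * ketbra v * mat_adjoint A) $$ (i, j) = ketbra (A *\<^sub>v v) $$ (i, j)"
    using assms by (simp add: ketbra_def scalar_prod_def sum_product sum_distrib_left sum_distrib_right mult_ac)
      (rule sum.swap)
qed (use assms in auto)

lemma mat_trace_mult_ketbra:
  assumes "P \<in> carrier_mat N N" "v \<in> carrier_vec N"
  shows "mat_trace (P * ketbra v) = (P *\<^sub>v v) \<bullet>c v"
  using assms by (simp add: mat_trace_def ketbra_def scalar_prod_def sum_distrib_left sum_distrib_right
      atLeast0LessThan mult_ac)

lemma ketbra_mult_vec: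
  assumes "b \<in> carrier_vec N" "v \<in> carrier_vec N"
  shows "ketbra b *\<^sub>v v = (v \<bullet>c b) \<cdot>\<^sub>v b"
  using assms
  by (intro eq_vecI) (auto simp: ketbra_def scalar_prod_def sum_distrib_left sum_distrib_right mult_ac)

text \<open>Applying W and reading the computational basis amounts to measuring in the basis formed
  by the columns of the adjoint of W.\<close>

lemma basis_projection_eq_ketbra:
  assumes W: "unitary_mat N W" and y: "y < N"
  shows "mat_adjoint W * ketbra (unit_vec N y) * W = ketbra (col (mat_adjoint W) y)"
proof -
  note W' = unitary_matD[OF W] note W'' = mat_adjoint_carrier[OF W'(1)]
  have "mat_adjoint W *\<^sub>v unit_vec N y = mat_adjoint W *\<^sub>v col (1\<^sub>m N) y" using y by simp
  also have "\<dots> = col (mat_adjoint W) y"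
    using W'' y by (subst col_mult2[symmetric, of _ N N _ N]) auto
  finally show ?thesis
    using ketbra_conjugate[OF W'', of "unit_vec N y"] by simp
qed

text \<open>The Born rule: entry y of W v is the inner product of v with column y of the adjoint of
  W. This connects amplitudes, as in \<open>outcome_prob\<close>, with traces against the
  projections of \<open>basis_measurement\<close>.\<close>

lemma trace_basis_projection:
  assumes W: "unitary_mat N W" and y: "y < N" and v: "v \<in> carrier_vec N"
  shows "mat_trace (mat_adjoint W * ketbra (unit_vec N y) * W * ketbra v) =
    complex_of_real ((cmod ((W *\<^sub>v v) $ y))\<^sup>2)"
proof -
  note W' = unitary_matD[OF W]
  let ?b = "col (mat_adjoint W) y"
  have b: "?b \<in> carrier_vec N" using W' y by auto
  have *: "(W *\<^sub>v v) $ y = v \<bullet>c ?b"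
    using W'(1) v y by (simp add: scalar_prod_def mult.commute)
  have "mat_trace (ketbra ?b * ketbra v) = (v \<bullet>c ?b) * (?b \<bullet>c v)"
    using mat_trace_mult_ketbra[of "ketbra ?b" N v] ketbra_mult_vec[OF b v] b v W'(1) by simp
  also have "?b \<bullet>c v = cnj (v \<bullet>c ?b)"
    using b v by (intro cnj_cscalar_prod[symmetric]) (simp only: carrier_vecD)
  finally show ?thesis
    unfolding basis_projection_eq_ketbra[OF W y] * complex_norm_square .
qed

lemma mat_mult_index:
  assumes "A \<in> carrier_mat l m" "B \<in> carrier_mat m n" "i < l" "j < n"
  shows "(A * B) $$ (i, j) = (\<Sum>k<m. A $$ (i, k) * B $$ (k, j))"
  using assms by (simp add: scalar_prod_def atLeast0LessThan)

text \<open>In a complete adapted basis, \<open>\<kappa>\<close> records which projection fixes each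
  vector; all other projections annihilate it. Hence \<open>Ps ! k\<close> is the sum of the
  rank-one projections onto the basis vectors that it fixes.\<close>

lemma projective_measurement_refine:
  assumes Ps: "projective_measurement N Ps"
  shows "\<exists>W \<kappa>. unitary_mat N W \<and> (\<forall>i<N. \<kappa> i < length Ps) \<and> (\<forall>k<length Ps.
    Ps ! k = mat_sum N (\<lambda>i. mat_adjoint W * ketbra (unit_vec N i) * W) {i \<in> {..<N}. \<kappa> i = k})"
proof -
  have "orthonormal N []" by (simp add: orthonormal_def)
  then obtain bs where bs: "orthonormal N bs" "length bs = N" "\<forall>b\<in>set bs. adapted Ps b"
    using orthonormal_extend[OF Ps, of "[]"] by auto
  then have "\<exists>k<length Ps. Ps ! k *\<^sub>v (bs ! i) = bs ! i" if "i < N" for i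
    using that by (auto simp: adapted_def)
  then obtain \<kappa> where \<kappa>: "\<And>i. i < N \<Longrightarrow> \<kappa> i < length Ps" "\<And>i. i < N \<Longrightarrow> Ps ! \<kappa> i *\<^sub>v (bs ! i) = bs ! i"
    by metis
  define B where "B = mat_of_cols N bs"
  have U: "unitary_mat N B" unfolding B_def by (rule orthonormal_unitary_mat[OF bs(1,2)])
  note B = unitary_matD[OF U]
  have bc: "bs ! i \<in> carrier_vec N" if "i < N" for i using that bs by (auto simp: orthonormal_def)
  have col: "col B i = bs ! i" if "i < N" for i
    unfolding B_def using that bs(2) bc[OF that] by (intro col_mat_of_cols) auto
  have "Ps ! k = mat_sum N (\<lambda>i. B * ketbra (unit_vec N i) * mat_adjoint B) {i \<in> {..<N}. \<kappa> i = k}"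
    if k: "k < length Ps" for k
  proof -
    have P: "Ps ! k \<in> carrier_mat N N" using projective_measurementD(1)[OF Ps k] .
    have Pb: "Ps ! k *\<^sub>v (bs ! i) = (if \<kappa> i = k then bs ! i else 0\<^sub>v N)" if i: "i < N" for i
      using \<kappa>(2)[OF i] projective_measurement_vec(2)[OF Ps \<kappa>(1)[OF i] bc[OF i] k] by auto
    have PB: "(Ps ! k * B) $$ (r, i) = (if \<kappa> i = k then bs ! i $ r else 0)" if "r < N" "i < N" for r i
    proof -
      have "(Ps ! k * B) $$ (r, i) = (Ps ! k *\<^sub>v (bs ! i)) $ r"
        using that P B(1) by (simp add: col)
      then show ?thesis using that by (simp add: Pb)
    qed
    \<comment> \<open>Inserting B times its adjoint, which is 1, lets the projection act on the
      columns of \<open>B\<close>, where its effect is known.\<close>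
    have "Ps ! k = Ps ! k * B * mat_adjoint B"
      using assoc_mult_mat[OF P B(1) mat_adjoint_carrier[OF B(1)]] B(3) P by simp
    also have "\<dots> = mat_sum N (\<lambda>i. ketbra (bs ! i)) {i \<in> {..<N}. \<kappa> i = k}"
    proof (rule eq_matI)
      fix r s assume "r < dim_row (mat_sum N (\<lambda>i. ketbra (bs ! i)) {i \<in> {..<N}. \<kappa> i = k})"
        "s < dim_col (mat_sum N (\<lambda>i. ketbra (bs ! i)) {i \<in> {..<N}. \<kappa> i = k})"
      then have rs: "r < N" "s < N" by auto
      have "(Ps ! k * B * mat_adjoint B) $$ (r, s) = (\<Sum>i<N. (Ps ! k * B) $$ (r, i) * cnj (B $$ (s, i)))"
        using rs B(1) mat_mult_index[OF mult_carrier_mat[OF P B(1)] mat_adjoint_carrier[OF B(1)]] by simp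
      also have "\<dots> = (\<Sum>i<N. if \<kappa> i = k then bs ! i $ r * cnj (bs ! i $ s) else 0)"
        using rs B(1) by (intro sum.cong) (auto simp: PB simp flip: col)
      also have "\<dots> = (\<Sum>i\<in>{i \<in> {..<N}. \<kappa> i = k}. bs ! i $ r * cnj (bs ! i $ s))"
        by (rule sum.inter_filter[symmetric]) simp
      also have "\<dots> = mat_sum N (\<lambda>i. ketbra (bs ! i)) {i \<in> {..<N}. \<kappa> i = k} $$ (r, s)"
        using rs carrier_vecD[OF bc] by (auto intro!: sum.cong)
      finally show "(Ps ! k * B * mat_adjoint B) $$ (r, s) =
        mat_sum N (\<lambda>i. ketbra (bs ! i)) {i \<in> {..<N}. \<kappa> i = k} $$ (r, s)" .
    qed (use P B(1) in auto)
    also have "\<dots> = mat_sum N (\<lambda>i. B * ketbra (unit_vec N i) * mat_adjoint B) {i \<in> {..<N}. \<kappa> i = k}"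
      using basis_projection_eq_ketbra[OF unitary_mat_adjoint[OF U]] by (intro mat_sum_cong) (auto simp: col)
    finally show ?thesis .
  qed
  \<comment> \<open>The witness for W is the adjoint of \<open>B\<close>, since the basis vectors
    have to be the columns of the adjoint of W.\<close>
  with \<kappa>(1) show ?thesis
    using unitary_mat_adjoint[OF U] by (intro exI[of _ "mat_adjoint B"] exI[of _ \<kappa>]) simp
qed

lemma basis_measurement_nth:
  "y < 2 ^ n \<Longrightarrow> basis_measurement n W ! y = mat_adjoint W * ketbra (unit_vec (2 ^ n) y) * W"
  by (simp add: basis_measurement_def)

lemma length_basis_measurement [simp]: "length (basis_measurement n W) = 2 ^ n"
  by (simp add: basis_measurement_def)

text \<open>Orthogonality of the projections comes from \<open>W * mat_adjoint W\<close>,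
  completeness from \<open>mat_adjoint W * W\<close>, each being the identity.\<close>

lemma basis_measurement_projective:
  assumes "unitary_mat (2 ^ n) W"
  shows "projective_measurement (2 ^ n) (basis_measurement n W)"
proof -
  define N where "N = (2 ^ n :: nat)"
  define B where "B = mat_adjoint W"
  have W: "unitary_mat N W" using assms by (simp add: N_def)
  note W' = unitary_matD[OF W]
  have B: "B \<in> carrier_mat N N" using W' by (simp add: B_def)
  define b where "b = col B"
  have b: "b y \<in> carrier_vec N" for y using B by (auto simp: b_def)
  have orth: "b y \<bullet>c b z = (if y = z then 1 else 0)" if "y < N" "z < N" for y z
  proof -
    have "b y \<bullet>c b z = (W * mat_adjoint W) $$ (z, y)"
      using that W'(1) by (simp add: b_def B_def scalar_prod_def mult.commute)
    then show ?thesis using W'(3) that by auto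
  qed
  have prod: "ketbra (b y) * ketbra (b z) = (if y = z then ketbra (b y) else 0\<^sub>m N N)"
    if yz: "y < N" "z < N" for y z
  proof (rule eq_matI)
    fix i j assume "i < dim_row (if y = z then ketbra (b y) else 0\<^sub>m N N)"
      "j < dim_col (if y = z then ketbra (b y) else 0\<^sub>m N N)"
    then have ij: "i < N" "j < N" by (auto simp: carrier_vecD[OF b] split: if_splits)
    have "(ketbra (b y) * ketbra (b z)) $$ (i, j) = b y $ i * (b z \<bullet>c b y) * cnj (b z $ j)"
      using ij b[THEN carrier_vecD] by (simp add: ketbra_def scalar_prod_def sum_distrib_left sum_distrib_right mult_ac)
    then show "(ketbra (b y) * ketbra (b z)) $$ (i, j) = (if y = z then ketbra (b y) else 0\<^sub>m N N) $$ (i, j)"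
      using ij b[THEN carrier_vecD] by (simp add: orth yz ketbra_def)
  qed (use b in auto)
  have herm: "mat_adjoint (ketbra (b y)) = ketbra (b y)" for y
    by (rule eq_matI) (auto simp: ketbra_def)
  have nth: "basis_measurement n W ! y = ketbra (b y)" if "y < N" for y
    using basis_projection_eq_ketbra[OF W that] that by (simp add: basis_measurement_def N_def b_def B_def)
  have len: "length (basis_measurement n W) = N" by (simp add: basis_measurement_def N_def)
  have "mat_sum N (\<lambda>k. basis_measurement n W ! k) {..<N} = B * mat_adjoint B"
  proof (rule eq_matI)
    fix i j assume "i < dim_row (B * mat_adjoint B)" "j < dim_col (B * mat_adjoint B)"
    then have "i < N" "j < N" using B by auto
    then show "mat_sum N (\<lambda>k. basis_measurement n W ! k) {..<N} $$ (i, j) = (B * mat_adjoint B) $$ (i, j)"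
      using B b[THEN carrier_vecD] by (simp add: nth ketbra_def b_def scalar_prod_def atLeast0LessThan)
  qed (use B in auto)
  then have "mat_sum N (\<lambda>k. basis_measurement n W ! k) {..<N} = 1\<^sub>m N"
    using W'(2) by (simp add: B_def)
  then show ?thesis
    unfolding projective_measurement_def N_def[symmetric] len
    using prod herm b by (auto simp: in_set_conv_nth nth len simp del: length_basis_measurement)
qed

section \<open>Entropy\<close>

text \<open>The unnormalized Shannon entropy: for weights \<open>w\<close> of total \<open>q\<close> it is \<open>q\<close> times the entropy of
  the distribution \<open>w / q\<close>.\<close>

definition weighted_entropy :: "'j set \<Rightarrow> ('j \<Rightarrow> real) \<Rightarrow> real" where
  "weighted_entropy L w = - (\<Sum>j\<in>L. w j * log 2 (w j / sum w L))"

text \<open>Each weight is at most the total, so every logarithm that occurs with a positive weight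
  is nonpositive.\<close>

lemma weighted_entropy_nonneg:
  assumes "finite L" "\<And>j. j \<in> L \<Longrightarrow> 0 \<le> w j"
  shows "0 \<le> weighted_entropy L w"
proof -
  have "w j * log 2 (w j / sum w L) \<le> 0" if j: "j \<in> L" for j
  proof (cases "w j = 0")
    case False
    then have "0 < w j" using assms(2)[OF j] by simp
    moreover have "w j \<le> sum w L" using assms j by (intro member_le_sum) auto
    ultimately show ?thesis by (intro mult_nonneg_nonpos) auto
  qed simp
  then show ?thesis by (simp add: weighted_entropy_def sum_nonpos)
qed

text \<open>The tangent bound on ln is multiplied by \<open>a i\<close> and summed; the linear
  corrections \<open>a i - A * b i / B\<close>, where A and B are the totals, add up to zero. The
  bound \<open>a i \<le> b i\<close> keeps \<open>b i\<close> positive wherever \<open>a i\<close>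
  is, so the convention \<open>a i / 0 = 0\<close> never meets a positive weight.\<close>

lemma log_sum_inequality:
  fixes a b :: "'i \<Rightarrow> real"
  assumes I: "finite I" and ab: "\<And>i. i \<in> I \<Longrightarrow> 0 \<le> a i \<and> a i \<le> b i"
  shows "sum a I * log 2 (sum a I / sum b I) \<le> (\<Sum>i\<in>I. a i * log 2 (a i / b i))"
proof (cases "sum a I = 0")
  case True
  then have "\<forall>i\<in>I. a i = 0" using I ab by (simp add: sum_nonneg_eq_0_iff)
  then show ?thesis by simp
next
  case False
  let ?A = "sum a I" and ?B = "sum b I"
  have A: "0 < ?A" using False ab sum_nonneg[of I a] by (simp add: less_le)
  have AB: "?A \<le> ?B" using ab by (intro sum_mono) auto
  then have B: "0 < ?B" using A by simp
  have "a i * ln (?A / ?B) + (a i - ?A * b i / ?B) \<le> a i * ln (a i / b i)" if i: "i \<in> I" for i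
  proof (cases "a i = 0")
    case True
    then show ?thesis using A B ab[OF i] by simp
  next
    case False
    then have ai: "0 < a i" "0 < b i" using ab[OF i] by auto
    \<comment> \<open>\<open>ln t \<le> t - 1\<close> at \<open>t = (A / B) / (a i / b i)\<close>\<close>
    have "ln ((?A / ?B) / (a i / b i)) \<le> (?A / ?B) / (a i / b i) - 1"
      using ai A B by (intro ln_le_minus_one) auto
    moreover have "ln ((?A / ?B) / (a i / b i)) = ln (?A / ?B) - ln (a i / b i)"
      using ai A B by (intro ln_divide_pos) auto
    ultimately have "ln (?A / ?B) - ln (a i / b i) \<le> (?A * b i / ?B) / a i - 1"
      by simp
    then have "a i * (ln (?A / ?B) - ln (a i / b i)) \<le> a i * ((?A * b i / ?B) / a i - 1)"
      using ai by (intro mult_left_mono) auto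
    then show ?thesis using ai by (simp add: algebra_simps)
  qed
  then have "(\<Sum>i\<in>I. a i * ln (?A / ?B) + (a i - ?A * b i / ?B)) \<le> (\<Sum>i\<in>I. a i * ln (a i / b i))"
    by (rule sum_mono)
  also have "(\<Sum>i\<in>I. a i * ln (?A / ?B) + (a i - ?A * b i / ?B)) = ?A * ln (?A / ?B)"
    using B by (simp add: sum.distrib sum_subtractf flip: sum_distrib_right sum_distrib_left sum_divide_distrib)
  finally have "?A * ln (?A / ?B) / ln 2 \<le> (\<Sum>i\<in>I. a i * ln (a i / b i)) / ln 2"
    by (intro divide_right_mono) auto
  then show ?thesis by (simp add: log_def sum_divide_distrib)
qed

text \<open>For each label j this is the log-sum inequality with \<open>a i = w i j\<close> and
  \<open>b i = sum (w i) L\<close>. In terms of information: merging outcomes cannot decrease the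
  conditional entropy of the label.\<close>

lemma weighted_entropy_superadditive:
  assumes "finite L" "finite I" "\<And>i j. i \<in> I \<Longrightarrow> j \<in> L \<Longrightarrow> 0 \<le> w i j"
  shows "(\<Sum>i\<in>I. weighted_entropy L (w i)) \<le> weighted_entropy L (\<lambda>j. \<Sum>i\<in>I. w i j)"
proof -
  have "(\<Sum>i\<in>I. w i j) * log 2 ((\<Sum>i\<in>I. w i j) / (\<Sum>i\<in>I. sum (w i) L))
      \<le> (\<Sum>i\<in>I. w i j * log 2 (w i j / sum (w i) L))" if "j \<in> L" for j
    using assms that by (intro log_sum_inequality) (auto intro!: member_le_sum)
  then have "(\<Sum>j\<in>L. (\<Sum>i\<in>I. w i j) * log 2 ((\<Sum>i\<in>I. w i j) / (\<Sum>i\<in>I. sum (w i) L)))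
      \<le> (\<Sum>j\<in>L. \<Sum>i\<in>I. w i j * log 2 (w i j / sum (w i) L))"
    by (rule sum_mono)
  also have "\<dots> = (\<Sum>i\<in>I. \<Sum>j\<in>L. w i j * log 2 (w i j / sum (w i) L))" by (rule sum.swap)
  also have "(\<Sum>i\<in>I. sum (w i) L) = (\<Sum>j\<in>L. \<Sum>i\<in>I. w i j)" by (rule sum.swap)
  finally show ?thesis by (simp add: weighted_entropy_def sum_negf)
qed

section \<open>Von Neumann entropy of a mixture of orthonormal states\<close>

lemma sum_mset_eq_sum_count:
  fixes f :: "'a \<Rightarrow> real"
  shows "(\<Sum>x\<in>#M. f x) = (\<Sum>x\<in>set_mset M. real (count M x) * f x)"
proof -
  \<comment> \<open>The induction runs over a fixed finite superset \<open>A\<close> of the support,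
    because the support itself can grow when an element is added.\<close>
  have "(\<Sum>x\<in>#M. f x) = (\<Sum>x\<in>A. real (count M x) * f x)" if "finite A" "set_mset M \<subseteq> A" for A
    using that(2)
  proof (induction M)
    case (add y M)
    have "(\<Sum>x\<in>A. real (count (add_mset y M) x) * f x) =
        (\<Sum>x\<in>A. (if x = y then f y else 0) + real (count M x) * f x)"
      by (intro sum.cong) (auto simp: algebra_simps)
    also have "\<dots> = f y + (\<Sum>x\<in>A. real (count M x) * f x)"
      using add.prems that(1) by (simp add: sum.distrib)
    finally show ?case using add by simp
  qed simp
  then show ?thesis by simp
qed

text \<open>The root multiset of a product of linear factors is \<open>mset as\<close>, so the root
  orders in \<open>vn_entropy\<close> are the multiplicities in the list. Repeated eigenvalues are
  thereby handled without case distinctions.\<close>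

lemma vn_entropy_char_poly:
  assumes "A \<in> carrier_mat d d" "char_poly A = (\<Prod>a\<leftarrow>as. [:- a, 1:])"
  shows "vn_entropy A = - (\<Sum>a\<leftarrow>as. Re a * log 2 (Re a))"
proof -
  let ?h = "\<lambda>a. Re a * log 2 (Re a)"
  have nz: "char_poly A \<noteq> 0"
    by (auto simp: assms(2) prod_list_zero_iff)
  have "proots (\<Prod>a\<leftarrow>xs. [:- a, 1:]) = mset xs" for xs :: "complex list"
  proof (induction xs)
    case (Cons x xs)
    have "(\<Prod>a\<leftarrow>xs. [:- a, 1:]) \<noteq> 0"
      by (auto simp: prod_list_zero_iff)
    then have "proots ([:- x, 1:] * (\<Prod>a\<leftarrow>xs. [:- a, 1:])) = {#x#} + mset xs"
      using Cons by (subst proots_mult) auto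
    then show ?case by simp
  qed simp
  then have "proots (char_poly A) = mset as"
    by (simp only: assms(2))
  then have "(\<Sum>e | eigenvalue A e. real (Polynomial.order e (char_poly A)) * ?h e) =
      (\<Sum>e\<in>set_mset (mset as). real (count (mset as) e) * ?h e)"
    using nz by (auto simp: eigenvalue_root_char_poly[OF assms(1)] simp flip: set_count_proots count_proots)
  also have "\<dots> = (\<Sum>e\<in>#mset as. ?h e)"
    by (rule sum_mset_eq_sum_count[symmetric])
  also have "\<dots> = (\<Sum>a\<leftarrow>as. ?h a)"
    by (simp flip: sum_mset_sum_list)
  finally show ?thesis by (simp add: vn_entropy_def)
qed

text \<open>There are as many kets as dimensions, so the matrix with the kets as columns is unitary
  and conjugates the mixture to a diagonal matrix. The weights may coincide, hence the passage
  through the factored characteristic polynomial.\<close>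

lemma vn_entropy_orthonormal_mixture:
  assumes "finite L" "\<And>j. j \<in> L \<Longrightarrow> ket j \<in> carrier_vec (card L)"
    "\<And>i j. i \<in> L \<Longrightarrow> j \<in> L \<Longrightarrow> ket i \<bullet>c ket j = (if i = j then 1 else 0)"
  shows "vn_entropy (mat_sum (card L) (\<lambda>j. complex_of_real (a j) \<cdot>\<^sub>m ketbra (ket j)) L) =
    - (\<Sum>j\<in>L. a j * log 2 (a j))"
proof -
  define d where "d = card L"
  obtain js where js: "set js = L" "distinct js"
    using finite_distinct_list[OF assms(1)] by blast
  then have len: "length js = d" using distinct_card[of js] by (simp add: d_def)
  have mem: "js ! i \<in> L" if "i < d" for i using that js(1) len nth_mem by blast
  note ket = assms(2)[folded d_def]
  define K where "K = mat_of_cols d (map ket js)"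
  have "orthonormal d (map ket js)"
    using ket js len by (auto simp: orthonormal_def assms(3) nth_eq_iff_index_eq mem)
  then have U: "unitary_mat d K"
    unfolding K_def using len by (intro orthonormal_unitary_mat) auto
  note K = unitary_matD[OF U]
  define D where "D = mat d d (\<lambda>(i, j). if i = j then complex_of_real (a (js ! i)) else 0)"
  have D: "D \<in> carrier_mat d d" by (simp add: D_def)
  define M where "M = mat_sum d (\<lambda>j. complex_of_real (a j) \<cdot>\<^sub>m ketbra (ket j)) L"
  have K_index: "K $$ (s, i) = ket (js ! i) $ s" if "s < d" "i < d" for s i
    using that len by (simp add: K_def mat_of_cols_index)
  have KD: "(K * D) $$ (r, i) = ket (js ! i) $ r * complex_of_real (a (js ! i))" if "r < d" "i < d" for r i
  proof -
    have "(K * D) $$ (r, i) = (\<Sum>k<d. if k = i then K $$ (r, i) * complex_of_real (a (js ! i)) else 0)"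
      unfolding mat_mult_index[OF K(1) D that] using that by (intro sum.cong) (auto simp: D_def)
    then show ?thesis using that len by (simp add: K_def mat_of_cols_index)
  qed
  have "M = K * D * mat_adjoint K"
  proof (rule eq_matI)
    fix r s assume "r < dim_row (K * D * mat_adjoint K)" "s < dim_col (K * D * mat_adjoint K)"
    then have rs: "r < d" "s < d" using K(1) by auto
    have "(K * D * mat_adjoint K) $$ (r, s) = (\<Sum>i<d. (K * D) $$ (r, i) * cnj (K $$ (s, i)))"
      using rs K(1) mat_mult_index[OF mult_carrier_mat[OF K(1) D] mat_adjoint_carrier[OF K(1)]] by simp
    also have "\<dots> = (\<Sum>i<d. complex_of_real (a (js ! i)) * ketbra (ket (js ! i)) $$ (r, s))"
      using rs carrier_vecD[OF ket[OF mem]]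
      by (intro sum.cong refl) (simp add: KD K_index)
    also have "\<dots> = (\<Sum>j\<in>L. complex_of_real (a j) * ketbra (ket j) $$ (r, s))"
      using bij_betw_nth[OF js(2), of "{..<d}" L] js(1) len
      by (intro sum.reindex_bij_betw) auto
    also have "\<dots> = M $$ (r, s)"
      using rs by (auto simp: M_def dest!: ket intro!: sum.cong)
    finally show "M $$ (r, s) = (K * D * mat_adjoint K) $$ (r, s)" by simp
  qed (use K(1) in \<open>auto simp: M_def\<close>)
  then have "similar_mat_wit M D K (mat_adjoint K)"
    using K D by (intro similar_mat_witI[of _ _ d]) (auto simp: M_def)
  then have "char_poly M = char_poly D"
    by (intro char_poly_similar) (auto simp: similar_mat_def)
  also have "\<dots> = (\<Prod>x\<leftarrow>diag_mat D. [:- x, 1:])"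
    by (rule char_poly_upper_triangular[OF D]) (auto simp: D_def upper_triangular_def)
  also have "diag_mat D = map (\<lambda>j. complex_of_real (a j)) js"
    by (rule nth_equalityI) (auto simp: diag_mat_def D_def len)
  finally have "vn_entropy M = - (\<Sum>x\<leftarrow>map (\<lambda>j. complex_of_real (a j)) js. Re x * log 2 (Re x))"
    by (intro vn_entropy_char_poly[of _ d]) (auto simp: M_def)
  also have "\<dots> = - (\<Sum>j\<in>L. a j * log 2 (a j))"
    using sum.distinct_set_conv_list[OF js(2), of "\<lambda>j. a j * log 2 (a j)"] js(1) by (simp add: o_def)
  finally show ?thesis by (simp add: M_def d_def)
qed

section \<open>Discord and mutual information of a query algorithm\<close>

lemma oracle_classification_problemD:
  assumes "oracle_classification_problem Q"
  shows "finite (identities Q)" "(\<Union>j\<in>labels Q. part Q j) = identities Q"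
    "disjoint_family_on (part Q) (labels Q)" "finite (labels Q)"
    "j \<in> labels Q \<Longrightarrow> part Q j \<noteq> {}" "j \<in> labels Q \<Longrightarrow> finite (part Q j)"
    "f \<in> identities Q \<Longrightarrow> unitary_mat (2 ^ qubits Q) (query_gate Q f)"
    "f \<in> identities Q \<Longrightarrow> 0 \<le> prior Q f" "(\<Sum>f\<in>identities Q. prior Q f) = 1"
    "j \<in> labels Q \<Longrightarrow> 0 < label_prob Q j"
proof -
  show 1: "finite (identities Q)" and 2: "(\<Union>j\<in>labels Q. part Q j) = identities Q"
    and 3: "disjoint_family_on (part Q) (labels Q)"
    and 4: "\<And>j. j \<in> labels Q \<Longrightarrow> part Q j \<noteq> {}"
    and "f \<in> identities Q \<Longrightarrow> unitary_mat (2 ^ qubits Q) (query_gate Q f)"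
    and "f \<in> identities Q \<Longrightarrow> 0 \<le> prior Q f" "(\<Sum>f\<in>identities Q. prior Q f) = 1"
    and "j \<in> labels Q \<Longrightarrow> 0 < label_prob Q j"
    using assms by (auto simp: oracle_classification_problem_def)
  show "finite (part Q j)" if "j \<in> labels Q"
    by (rule finite_subset[OF _ 1]) (use that 2 in auto)
  \<comment> \<open>Finiteness of the label set is derived: nonempty disjoint classes are distinct,
    so \<open>part Q\<close> embeds the labels into the power set of the finite set of
    identities.\<close>
  have "inj_on (part Q) (labels Q)"
    using 3 4 unfolding disjoint_family_on_def inj_on_def by blast
  moreover have "part Q ` labels Q \<subseteq> Pow (identities Q)" using 2 by auto
  ultimately show "finite (labels Q)" using 1 by (metis finite_Pow_iff finite_imageD finite_subset)
qed

lemma part_subset_identities: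
  "oracle_classification_problem Q \<Longrightarrow> j \<in> labels Q \<Longrightarrow> f \<in> part Q j \<Longrightarrow> f \<in> identities Q"
  using oracle_classification_problemD(2) by fastforce

text \<open>Disjointness of the classes makes the definite description in \<open>label_of\<close>
  unique. The condition \<open>j \<in> labels Q\<close> stands on both sides because
  \<open>part Q\<close> is unconstrained outside the labels.\<close>

lemma label_of_iff:
  assumes "oracle_classification_problem Q" "f \<in> identities Q"
  shows "j \<in> labels Q \<and> label_of Q f = j \<longleftrightarrow> j \<in> labels Q \<and> f \<in> part Q j"
proof -
  note D = oracle_classification_problemD[OF assms(1)]
  obtain i where i: "i \<in> labels Q" "f \<in> part Q i" using D(2) assms(2) by auto
  have uniq: "k = i" if "k \<in> labels Q" "f \<in> part Q k" for k
    using D(3) i that unfolding disjoint_family_on_def by blast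
  have "label_of Q f = i"
    unfolding label_of_def using i by (intro the_equality) (blast intro: uniq)+
  then show ?thesis using i uniq by metis
qed

lemma sum_identities:
  assumes "oracle_classification_problem Q"
  shows "(\<Sum>f\<in>identities Q. h f) = (\<Sum>j\<in>labels Q. \<Sum>f\<in>part Q j. h f)"
proof -
  note D = oracle_classification_problemD[OF assms]
  show ?thesis
    unfolding D(2)[symmetric] using D(3,4,6)
    by (intro sum.UNION_disjoint) (auto simp: disjoint_family_on_def)
qed

lemma query_unitary_mat:
  assumes "oracle_classification_problem Q" "qubits Q \<le> n" "f \<in> identities Q"
  shows "unitary_mat (2 ^ n) (query Q n f)"
proof -
  have "unitary_mat (2 ^ (n - qubits Q)) (1\<^sub>m (2 ^ (n - qubits Q)))"
    by (simp add: unitary_mat_def)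
  from kron_unitary[OF oracle_classification_problemD(7)[OF assms(1,3)] this] show ?thesis
    using assms(2) by (simp add: query_def flip: power_add)
qed

text \<open>This is w_P(j), equal to p_j Tr(P sigma_j) when P is a projection. Summing over oracles
  makes it real by definition, avoids dividing by p_j, and fits the distribution given by
  \<open>outcome_prob\<close>.\<close>

definition class_weight ::
    "('f, 'j) oracle_problem \<Rightarrow> nat \<Rightarrow> complex vec \<Rightarrow> complex mat \<Rightarrow> 'j \<Rightarrow> real" where
  "class_weight Q n \<psi> P j =
     (\<Sum>f\<in>part Q j. prior Q f * Re (mat_trace (P * ketbra (query Q n f *\<^sub>v \<psi>))))"

text \<open>Idempotence and self-adjointness turn the trace into the squared norm of P v.\<close>

lemma mat_trace_projection:
  assumes "P \<in> carrier_mat N N" "mat_adjoint P = P" "P * P = P" "v \<in> carrier_vec N"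
  shows "0 \<le> Re (mat_trace (P * ketbra v))"
    and "mat_trace (P * ketbra v) = complex_of_real (Re (mat_trace (P * ketbra v)))"
proof -
  have Pv: "P *\<^sub>v v \<in> carrier_vec N" using assms(1,4) by (rule mult_mat_vec_carrier)
  have "mat_trace (P * ketbra v) = (P *\<^sub>v (P *\<^sub>v v)) \<bullet>c v"
    using mat_trace_mult_ketbra[OF assms(1,4)] assoc_mult_mat_vec[OF assms(1,1,4)] assms(3) by simp
  also have "\<dots> = (P *\<^sub>v v) \<bullet>c (P *\<^sub>v v)"
    using cscalar_prod_mult_mat_vec[OF assms(1) Pv assms(4)] assms(2) by simp
  finally have *: "mat_trace (P * ketbra v) =
    complex_of_real (\<Sum>i<dim_vec (P *\<^sub>v v). (cmod ((P *\<^sub>v v) $ i))\<^sup>2)"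
    unfolding cscalar_prod_self .
  show "0 \<le> Re (mat_trace (P * ketbra v))"
    unfolding * Re_complex_of_real by (intro sum_nonneg) auto
  show "mat_trace (P * ketbra v) = complex_of_real (Re (mat_trace (P * ketbra v)))"
    unfolding * Re_complex_of_real ..
qed

section \<open>Class weights and the discord of a projective measurement, for a fixed pre-query
  state\<close>

context
  fixes Q :: "('f, 'j) oracle_problem" and n :: nat and \<psi> :: "complex vec"
  assumes Q: "oracle_classification_problem Q" and n: "qubits Q \<le> n"
    and \<psi>: "normalized (2 ^ n) \<psi>"
begin

lemma post_query_vec_normalized:
  "f \<in> identities Q \<Longrightarrow> normalized (2 ^ n) (query Q n f *\<^sub>v \<psi>)"
  by (rule unitary_mat_normalized[OF query_unitary_mat[OF Q n] \<psi>])

lemma post_query_vec_carrier: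
  "f \<in> identities Q \<Longrightarrow> query Q n f *\<^sub>v \<psi> \<in> carrier_vec (2 ^ n)"
  using post_query_vec_normalized by (simp add: normalized_def)

lemma class_weight_nonneg:
  assumes "P \<in> carrier_mat (2 ^ n) (2 ^ n)" "mat_adjoint P = P" "P * P = P" "j \<in> labels Q"
  shows "0 \<le> class_weight Q n \<psi> P j"
  unfolding class_weight_def using part_subset_identities[OF Q assms(4)]
  by (intro sum_nonneg mult_nonneg_nonneg oracle_classification_problemD(8)[OF Q]
      mat_trace_projection(1)[OF assms(1-3)] post_query_vec_carrier)

text \<open>With this additivity the weights of a coarse outcome are the sums of the weights of the
  outcomes that refine it.\<close>

lemma class_weight_mat_sum:
  assumes "\<And>i. i \<in> I \<Longrightarrow> M i \<in> carrier_mat (2 ^ n) (2 ^ n)" "j \<in> labels Q"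
  shows "class_weight Q n \<psi> (mat_sum (2 ^ n) M I) j = (\<Sum>i\<in>I. class_weight Q n \<psi> (M i) j)"
proof -
  have "mat_trace (mat_sum (2 ^ n) M I * ketbra (query Q n f *\<^sub>v \<psi>)) =
      (\<Sum>i\<in>I. mat_trace (M i * ketbra (query Q n f *\<^sub>v \<psi>)))" if "f \<in> part Q j" for f
  proof -
    have k: "ketbra (query Q n f *\<^sub>v \<psi>) \<in> carrier_mat (2 ^ n) (2 ^ n)"
      using that part_subset_identities[OF Q assms(2)] post_query_vec_carrier by auto
    show ?thesis
      by (subst mat_sum_mult_right[OF k], rule assms(1), assumption, rule mat_trace_mat_sum[where N = "2 ^ n"])
        (rule mult_carrier_mat[OF assms(1) k])
  qed
  then have "class_weight Q n \<psi> (mat_sum (2 ^ n) M I) j =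
      (\<Sum>f\<in>part Q j. \<Sum>i\<in>I. prior Q f * Re (mat_trace (M i * ketbra (query Q n f *\<^sub>v \<psi>))))"
    unfolding class_weight_def by (intro sum.cong) (auto simp: sum_distrib_left)
  also have "\<dots> = (\<Sum>i\<in>I. class_weight Q n \<psi> (M i) j)"
    unfolding class_weight_def by (rule sum.swap)
  finally show ?thesis .
qed

lemma post_query_state_eq:
  assumes "j \<in> labels Q"
  shows "post_query_state Q n \<psi> j = mat_sum (2 ^ n)
    (\<lambda>f. complex_of_real (prior Q f / label_prob Q j) \<cdot>\<^sub>m ketbra (query Q n f *\<^sub>v \<psi>)) (part Q j)"
proof -
  have "\<psi> \<in> carrier_vec (2 ^ n)" using \<psi> by (simp add: normalized_def)
  then show ?thesis
    unfolding post_query_state_def using part_subset_identities[OF Q assms]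
    by (intro mat_sum_cong) (auto simp: ketbra_conjugate[OF unitary_matD(1)[OF query_unitary_mat[OF Q n]]])
qed

text \<open>The positive factor \<open>label_prob Q j\<close> cancels the denominators in
  \<open>post_query_state\<close>. That P is a projection makes the traces real, so the real part
  taken in \<open>class_weight\<close> loses nothing.\<close>

lemma mat_trace_mult_post_query_state:
  assumes P: "P \<in> carrier_mat (2 ^ n) (2 ^ n)" "mat_adjoint P = P" "P * P = P" and j: "j \<in> labels Q"
  shows "complex_of_real (label_prob Q j) * mat_trace (P * post_query_state Q n \<psi> j) =
    complex_of_real (class_weight Q n \<psi> P j)"
proof -
  have k: "ketbra (query Q n f *\<^sub>v \<psi>) \<in> carrier_mat (2 ^ n) (2 ^ n)" if "f \<in> part Q j" for f
    using that part_subset_identities[OF Q j] post_query_vec_carrier by auto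
  have "mat_trace (P * post_query_state Q n \<psi> j) = mat_trace (mat_sum (2 ^ n)
      (\<lambda>f. P * (complex_of_real (prior Q f / label_prob Q j) \<cdot>\<^sub>m ketbra (query Q n f *\<^sub>v \<psi>))) (part Q j))"
    unfolding post_query_state_eq[OF j] by (subst mat_sum_mult_left[OF P(1)]) (auto simp: k)
  also have "\<dots> = (\<Sum>f\<in>part Q j.
      mat_trace (P * (complex_of_real (prior Q f / label_prob Q j) \<cdot>\<^sub>m ketbra (query Q n f *\<^sub>v \<psi>))))"
    by (rule mat_trace_mat_sum[where N = "2 ^ n"]) (intro mult_carrier_mat[OF P(1)] smult_carrier_mat k)
  also have "\<dots> = (\<Sum>f\<in>part Q j. complex_of_real (prior Q f / label_prob Q j) *
      complex_of_real (Re (mat_trace (P * ketbra (query Q n f *\<^sub>v \<psi>)))))"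
  proof (rule sum.cong)
    fix f assume f: "f \<in> part Q j"
    have v: "query Q n f *\<^sub>v \<psi> \<in> carrier_vec (2 ^ n)"
      using f part_subset_identities[OF Q j] post_query_vec_carrier by auto
    show "mat_trace (P * (complex_of_real (prior Q f / label_prob Q j) \<cdot>\<^sub>m ketbra (query Q n f *\<^sub>v \<psi>))) =
      complex_of_real (prior Q f / label_prob Q j) *
      complex_of_real (Re (mat_trace (P * ketbra (query Q n f *\<^sub>v \<psi>))))"
      unfolding mult_smult_distrib[OF P(1) k[OF f]]
        mat_trace_smult[OF mult_carrier_mat[OF P(1) k[OF f]]]
      using mat_trace_projection(2)[OF P v] by simp
  qed simp
  also have "\<dots> = complex_of_real (class_weight Q n \<psi> P j / label_prob Q j)"
    by (simp add: class_weight_def sum_divide_distrib)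
  finally show ?thesis
    using oracle_classification_problemD(10)[OF Q j] by simp
qed

text \<open>An operator on Y alone leaves the label projections untouched, so the state remains a
  sum over labels of tensor products and only the Y factors change.\<close>

lemma kron_one_mult_rho_JY:
  assumes ket: "label_basis Q ket" and P: "P \<in> carrier_mat (2 ^ n) (2 ^ n)"
  shows "kron (1\<^sub>m (card (labels Q))) P * rho_JY Q ket n \<psi> = mat_sum (card (labels Q) * 2 ^ n)
      (\<lambda>j. complex_of_real (label_prob Q j) \<cdot>\<^sub>m kron (ketbra (ket j)) (P * post_query_state Q n \<psi> j)) (labels Q)"
    and "kron (1\<^sub>m (card (labels Q))) P * rho_JY Q ket n \<psi> * kron (1\<^sub>m (card (labels Q))) P =
      mat_sum (card (labels Q) * 2 ^ n)
      (\<lambda>j. complex_of_real (label_prob Q j) \<cdot>\<^sub>m kron (ketbra (ket j)) (P * post_query_state Q n \<psi> j * P)) (labels Q)"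
proof -
  let ?d = "card (labels Q)" and ?N = "2 ^ n :: nat"
  let ?KP = "kron (1\<^sub>m ?d) P"
  have K: "ketbra (ket j) \<in> carrier_mat ?d ?d" if "j \<in> labels Q" for j
    using ket that by (auto simp: label_basis_def)
  have S: "post_query_state Q n \<psi> j \<in> carrier_mat ?N ?N" for j
    by (simp add: post_query_state_def)
  have PS: "P * post_query_state Q n \<psi> j \<in> carrier_mat ?N ?N" for j
    using P S by (rule mult_carrier_mat)
  have KP: "?KP \<in> carrier_mat (?d * ?N) (?d * ?N)"
    by (rule kron_carrier[OF one_carrier_mat P])
  have 1: "?KP * (c \<cdot>\<^sub>m kron (ketbra (ket j)) (post_query_state Q n \<psi> j)) =
      c \<cdot>\<^sub>m kron (ketbra (ket j)) (P * post_query_state Q n \<psi> j)" if "j \<in> labels Q" for j c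
    unfolding mult_smult_distrib[OF KP kron_carrier[OF K[OF that] S]]
      kron_mult[OF one_carrier_mat P K[OF that] S] left_mult_one_mat[OF K[OF that]] ..
  have 2: "(c \<cdot>\<^sub>m kron (ketbra (ket j)) (P * post_query_state Q n \<psi> j)) * ?KP =
      c \<cdot>\<^sub>m kron (ketbra (ket j)) (P * post_query_state Q n \<psi> j * P)" if "j \<in> labels Q" for j c
    unfolding mult_smult_assoc_mat[OF kron_carrier[OF K[OF that] PS] KP]
      kron_mult[OF K[OF that] PS one_carrier_mat P] right_mult_one_mat[OF K[OF that]] ..
  show 3: "?KP * rho_JY Q ket n \<psi> = mat_sum (?d * ?N)
      (\<lambda>j. complex_of_real (label_prob Q j) \<cdot>\<^sub>m kron (ketbra (ket j)) (P * post_query_state Q n \<psi> j)) (labels Q)"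
    unfolding rho_JY_def
    by (subst mat_sum_mult_left[OF KP]) (auto intro!: mat_sum_cong smult_carrier_mat kron_carrier K S 1)
  show "?KP * rho_JY Q ket n \<psi> * ?KP = mat_sum (?d * ?N)
      (\<lambda>j. complex_of_real (label_prob Q j) \<cdot>\<^sub>m kron (ketbra (ket j)) (P * post_query_state Q n \<psi> j * P)) (labels Q)"
    unfolding 3
    by (subst mat_sum_mult_right[OF KP]) (auto intro!: mat_sum_cong smult_carrier_mat kron_carrier K PS 2)
qed

lemma outcome_weight_eq:
  assumes ket: "label_basis Q ket"
    and P: "P \<in> carrier_mat (2 ^ n) (2 ^ n)" "mat_adjoint P = P" "P * P = P"
  shows "outcome_weight (card (labels Q)) (rho_JY Q ket n \<psi>) P = (\<Sum>j\<in>labels Q. class_weight Q n \<psi> P j)"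
proof -
  let ?d = "card (labels Q)" and ?N = "2 ^ n :: nat"
  have K: "ketbra (ket j) \<in> carrier_mat ?d ?d" "mat_trace (ketbra (ket j)) = 1" if "j \<in> labels Q" for j
  proof -
    have c: "ket j \<in> carrier_vec ?d" "ket j \<bullet>c ket j = 1" using ket that by (auto simp: label_basis_def)
    then show "ketbra (ket j) \<in> carrier_mat ?d ?d" by simp
    show "mat_trace (ketbra (ket j)) = 1"
      using c by (simp add: mat_trace_def scalar_prod_def atLeast0LessThan)
  qed
  have PS: "P * post_query_state Q n \<psi> j \<in> carrier_mat ?N ?N" for j
    using P(1) by (rule mult_carrier_mat) (simp add: post_query_state_def)
  have "mat_trace (kron (1\<^sub>m ?d) P * rho_JY Q ket n \<psi>) = (\<Sum>j\<in>labels Q.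
      mat_trace (complex_of_real (label_prob Q j) \<cdot>\<^sub>m kron (ketbra (ket j)) (P * post_query_state Q n \<psi> j)))"
    unfolding kron_one_mult_rho_JY(1)[OF ket P(1)]
    by (rule mat_trace_mat_sum[where N = "?d * ?N"]) (intro smult_carrier_mat kron_carrier K PS)
  also have "\<dots> = (\<Sum>j\<in>labels Q. complex_of_real (class_weight Q n \<psi> P j))"
  proof (rule sum.cong)
    fix j assume j: "j \<in> labels Q"
    show "mat_trace (complex_of_real (label_prob Q j) \<cdot>\<^sub>m kron (ketbra (ket j)) (P * post_query_state Q n \<psi> j)) =
      complex_of_real (class_weight Q n \<psi> P j)"
      unfolding mat_trace_smult[OF kron_carrier[OF K(1)[OF j] PS]] mat_trace_kron[OF K(1)[OF j] PS] K(2)[OF j]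
      using mat_trace_mult_post_query_state[OF P j] by simp
  qed simp
  finally show ?thesis by (simp add: outcome_weight_def)
qed

text \<open>Tracing out Y leaves the sum of w_j / q times the projection onto the ket of j, with q
  the total weight; its entropy is read off from these coefficients.\<close>

lemma conditional_entropy_term:
  assumes ket: "label_basis Q ket"
    and P: "P \<in> carrier_mat (2 ^ n) (2 ^ n)" "mat_adjoint P = P" "P * P = P"
  defines "R \<equiv> rho_JY Q ket n \<psi>" and "d \<equiv> card (labels Q)"
  shows "outcome_weight d R P * vn_entropy (conditional_state d (2 ^ n) R P) =
    weighted_entropy (labels Q) (class_weight Q n \<psi> P)"
proof -
  let ?N = "2 ^ n :: nat" and ?w = "class_weight Q n \<psi> P"
  have K: "ketbra (ket j) \<in> carrier_mat d d" if "j \<in> labels Q" for j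
    using ket that by (auto simp: label_basis_def d_def)
  have S: "post_query_state Q n \<psi> j \<in> carrier_mat ?N ?N" for j
    by (simp add: post_query_state_def)
  have PS: "P * post_query_state Q n \<psi> j \<in> carrier_mat ?N ?N" for j
    using P(1) S by (rule mult_carrier_mat)
  \<comment> \<open>Cyclicity of the trace and \<open>P * P = P\<close> remove the projection on the
    right.\<close>
  have tr: "mat_trace (P * post_query_state Q n \<psi> j * P) = mat_trace (P * post_query_state Q n \<psi> j)" for j
    unfolding mat_trace_mult_commute[OF PS P(1)] assoc_mult_mat[OF P(1) P(1) S, symmetric] P(3) ..
  define q where "q = sum ?w (labels Q)"
  have q: "outcome_weight d R P = q"
    unfolding R_def d_def q_def by (rule outcome_weight_eq[OF ket P])
  have "trace_out_Y d ?N (kron (1\<^sub>m d) P * R * kron (1\<^sub>m d) P) =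
     mat_sum d (\<lambda>j. (complex_of_real (label_prob Q j) * mat_trace (P * post_query_state Q n \<psi> j * P)) \<cdot>\<^sub>m
       ketbra (ket j)) (labels Q)"
    unfolding R_def d_def kron_one_mult_rho_JY(2)[OF ket P(1)]
    by (rule trace_out_Y_mat_sum_kron) (auto intro: K[unfolded d_def] mult_carrier_mat[OF PS P(1)])
  also have "\<dots> = mat_sum d (\<lambda>j. complex_of_real (?w j) \<cdot>\<^sub>m ketbra (ket j)) (labels Q)"
    by (intro mat_sum_cong) (simp add: tr mat_trace_mult_post_query_state[OF P])
  finally have "conditional_state d ?N R P =
      complex_of_real (1 / q) \<cdot>\<^sub>m mat_sum d (\<lambda>j. complex_of_real (?w j) \<cdot>\<^sub>m ketbra (ket j)) (labels Q)"
    by (simp add: conditional_state_def q)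
  also have "\<dots> = mat_sum d (\<lambda>j. complex_of_real (?w j / q) \<cdot>\<^sub>m ketbra (ket j)) (labels Q)"
    by (rule eq_matI) (auto simp: sum_divide_distrib sum_distrib_left dest!: K intro!: sum.cong)
  finally have "vn_entropy (conditional_state d ?N R P) = - (\<Sum>j\<in>labels Q. ?w j / q * log 2 (?w j / q))"
    using vn_entropy_orthonormal_mixture[of "labels Q" ket "\<lambda>j. ?w j / q"] ket
      oracle_classification_problemD(4)[OF Q]
    by (simp add: label_basis_def d_def)
  then show ?thesis
    \<comment> \<open>For \<open>q = 0\<close> both sides vanish: on the right the quotients by zero
      are 0, and \<open>log 2 0 = 0\<close>.\<close>
    unfolding q weighted_entropy_def q_def[symmetric]
    by (cases "q = 0") (auto simp: sum_distrib_left log_def)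
qed

lemma discord_Y_eq:
  assumes ket: "label_basis Q ket" and Ps: "projective_measurement (2 ^ n) Ps"
  defines "R \<equiv> rho_JY Q ket n \<psi>" and "d \<equiv> card (labels Q)"
  shows "discord_Y d (2 ^ n) R Ps = vn_entropy (trace_out_J d (2 ^ n) R) - vn_entropy R +
    (\<Sum>k<length Ps. weighted_entropy (labels Q) (class_weight Q n \<psi> (Ps ! k)))"
  unfolding discord_Y_def conditional_entropy_meas_def R_def d_def
  using conditional_entropy_term[OF ket projective_measurementD(1-3)[OF Ps]]
  by (simp add: sum_list_sum_nth atLeast0LessThan)

end

section \<open>Mutual information and its comparison with discord\<close>

context
  fixes Q :: "('f, 'j) oracle_problem" and n :: nat and \<psi> :: "complex vec"
  assumes Q: "oracle_classification_problem Q" and n: "qubits Q \<le> n"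
    and \<psi>: "normalized (2 ^ n) \<psi>"
begin

lemma class_weight_basis_projection:
  assumes "unitary_mat (2 ^ n) W" "y < 2 ^ n" "j \<in> labels Q"
  shows "class_weight Q n \<psi> (mat_adjoint W * ketbra (unit_vec (2 ^ n) y) * W) j =
    (\<Sum>f\<in>part Q j. prior Q f * outcome_prob Q n \<psi> W f y)"
  unfolding class_weight_def outcome_prob_def
  using trace_basis_projection[OF assms(1,2) post_query_vec_carrier[OF Q n \<psi>]]
    part_subset_identities[OF Q assms(3)]
  by (intro sum.cong) auto

lemma sum_outcome_prob:
  assumes "unitary_mat (2 ^ n) W" "f \<in> identities Q"
  shows "(\<Sum>y<2 ^ n. outcome_prob Q n \<psi> W f y) = 1"
proof -
  let ?v = "W *\<^sub>v (query Q n f *\<^sub>v \<psi>)"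
  have v: "normalized (2 ^ n) ?v"
    using unitary_mat_normalized[OF assms(1) post_query_vec_normalized[OF Q n \<psi> assms(2)]] .
  then have "complex_of_real (\<Sum>y<dim_vec ?v. (cmod (?v $ y))\<^sup>2) = 1"
    unfolding cscalar_prod_self[symmetric] by (simp add: normalized_def)
  then have "(\<Sum>y<dim_vec ?v. (cmod (?v $ y))\<^sup>2) = 1"
    by (simp only: of_real_eq_1_iff)
  moreover have "dim_vec ?v = 2 ^ n"
    using v by (auto simp: normalized_def simp del: dim_mult_mat_vec)
  ultimately show ?thesis by (simp add: outcome_prob_def)
qed

text \<open>This is I(J;Y) = H(J) - H(J|Y): each logarithm of p(j,y) / (p(j) p(y)) splits into log
  p(j|y) and log p(j), and summing the latter over y leaves the prior of the label.\<close>

lemma mutual_info_eq: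
  assumes W: "unitary_mat (2 ^ n) W"
  shows "mutual_info Q n \<psi> W = - (\<Sum>j\<in>labels Q. label_prob Q j * log 2 (label_prob Q j)) -
    (\<Sum>y<2 ^ n. weighted_entropy (labels Q)
      (class_weight Q n \<psi> (mat_adjoint W * ketbra (unit_vec (2 ^ n) y) * W)))"
proof -
  define N where "N = (2 ^ n :: nat)"
  define D where "D = (\<lambda>(f, y). prior Q f * outcome_prob Q n \<psi> W f y)"
  define M where "M = joint_distribution Q n \<psi> W"
  define X where "X = (\<lambda>(f :: 'f, y :: nat). label_of Q f)"
  define Y where "Y = (\<lambda>(f :: 'f, y :: nat). y)"
  define w where "w y j = (\<Sum>f\<in>part Q j. D (f, y))" for y j
  note Q' = oracle_classification_problemD[OF Q]
  have N: "0 < N" by (simp add: N_def)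
  have fin: "finite (identities Q \<times> {..<N})" using Q'(1) by simp
  have D_nonneg: "0 \<le> D x" if "x \<in> identities Q \<times> {..<N}" for x
    using that Q'(8) by (auto simp: D_def outcome_prob_def)
  have M_eq: "M = point_measure (identities Q \<times> {..<N}) (\<lambda>x. ennreal (D x))"
    unfolding M_def joint_distribution_def D_def N_def by (simp add: case_prod_unfold)
  have space: "space M = identities Q \<times> {..<N}" by (simp add: M_eq space_point_measure)
  have meas: "measure M S = sum D S" if "S \<subseteq> identities Q \<times> {..<N}" for S
    unfolding M_eq using measure_point_measure_finite_if[OF fin, of D S] D_nonneg that by simp
  have rowsum: "(\<Sum>y<N. D (f, y)) = prior Q f" if "f \<in> identities Q" for f
    using sum_outcome_prob[OF W that] by (simp add: D_def N_def flip: sum_distrib_left)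
  have total: "sum D (identities Q \<times> {..<N}) = 1"
    using Q'(9) by (simp add: sum.cartesian_product' rowsum flip: sum.cartesian_product)
  interpret prob_space M
  proof
    have "emeasure M (identities Q \<times> {..<N}) = (\<Sum>x\<in>identities Q \<times> {..<N}. ennreal (D x))"
      unfolding M_eq by (rule emeasure_point_measure_finite[OF fin]) simp
    also have "\<dots> = 1" using total by (simp add: sum_ennreal D_nonneg)
    finally show "emeasure M (space M) = 1" unfolding space .
  qed
  interpret information_space M 2 by standard simp
  \<comment> \<open>The library formula uses counting spaces on the images of the random variables,
    so these images must be shown to be \<open>labels Q\<close> and \<open>{..<N}\<close>. The space
    of \<open>M\<close> is the full product, points of probability zero included, and every class is
    nonempty.\<close>
  have X_space: "X ` space M = labels Q"
  proof
    have "label_of Q f \<in> labels Q" if f: "f \<in> identities Q" for f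
    proof -
      obtain j where "j \<in> labels Q" "f \<in> part Q j" using Q'(2) f by auto
      then show ?thesis using label_of_iff[OF Q f, of j] by simp
    qed
    then show "X ` space M \<subseteq> labels Q" by (auto simp: space X_def)
    show "labels Q \<subseteq> X ` space M"
    proof
      fix j assume j: "j \<in> labels Q"
      then obtain f where "f \<in> part Q j" using Q'(5) by auto
      then have "f \<in> identities Q" "label_of Q f = j"
        using j part_subset_identities[OF Q j] label_of_iff[OF Q] by blast+
      then show "j \<in> X ` space M" using N unfolding space X_def by force
    qed
  qed
  have ids: "identities Q \<noteq> {}" using Q'(9) by auto
  have Y_space: "Y ` space M = {..<N}" using ids by (auto simp: space Y_def image_iff)
  have X_vimage: "X -` {j} \<inter> space M = part Q j \<times> {..<N}" if j: "j \<in> labels Q" for j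
    using label_of_iff[OF Q, of _ j] j part_subset_identities[OF Q j] unfolding space X_def by fastforce
  have XY_space: "(\<lambda>x. (X x, Y x)) ` space M = labels Q \<times> {..<N}"
  proof -
    have "(j, y) \<in> (\<lambda>x. (X x, Y x)) ` space M" if "j \<in> labels Q" "y < N" for j y
    proof -
      obtain f where "f \<in> part Q j" using Q'(5) \<open>j \<in> labels Q\<close> by auto
      then have "(f, y) \<in> X -` {j} \<inter> space M" using X_vimage that by auto
      then show ?thesis by (auto simp: Y_def image_iff intro!: bexI[of _ "(f, y)"])
    qed
    then show ?thesis using X_space Y_space by fast
  qed
  \<comment> \<open>The distributions enter as measures of fibres, the form that
    \<open>simple_distributedI\<close> asks for; their values are computed afterwards.\<close>
  define Px where "Px j = measure M (X -` {j} \<inter> space M)" for j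
  define Py where "Py y = measure M (Y -` {y} \<inter> space M)" for y
  define Pxy where "Pxy z = measure M ((\<lambda>x. (X x, Y x)) -` {z} \<inter> space M)" for z
  have part_sub: "part Q j \<subseteq> identities Q" if "j \<in> labels Q" for j
    using part_subset_identities[OF Q that] by auto
  have Px: "Px j = label_prob Q j" if j: "j \<in> labels Q" for j
  proof -
    have "Px j = sum D (part Q j \<times> {..<N})"
      unfolding Px_def X_vimage[OF j] by (rule meas) (use part_sub[OF j] in auto)
    also have "\<dots> = (\<Sum>f\<in>part Q j. \<Sum>y<N. D (f, y))"
      by (simp add: sum.cartesian_product)
    also have "\<dots> = label_prob Q j"
      unfolding label_prob_def using rowsum part_sub[OF j] by (intro sum.cong) auto
    finally show ?thesis .
  qed
  have Py: "Py y = sum (w y) (labels Q)" if y: "y < N" for y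
  proof -
    have "Y -` {y} \<inter> space M = (\<lambda>f. (f, y)) ` identities Q"
      using y by (auto simp: space Y_def)
    then have "Py y = sum D ((\<lambda>f. (f, y)) ` identities Q)"
      unfolding Py_def using meas[of "(\<lambda>f. (f, y)) ` identities Q"] y by auto
    also have "\<dots> = (\<Sum>f\<in>identities Q. D (f, y))"
      by (subst sum.reindex) (auto simp: inj_on_def)
    finally show ?thesis unfolding w_def sum_identities[OF Q] .
  qed
  have Pxy: "Pxy (j, y) = w y j" if j: "j \<in> labels Q" and y: "y < N" for j y
  proof -
    have "(\<lambda>x. (X x, Y x)) -` {(j, y)} \<inter> space M = (X -` {j} \<inter> space M) \<inter> {x. Y x = y}"
      by auto
    also have "\<dots> = (\<lambda>f. (f, y)) ` part Q j"
      unfolding X_vimage[OF j] using y by (auto simp: Y_def)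
    finally have "Pxy (j, y) = sum D ((\<lambda>f. (f, y)) ` part Q j)"
      unfolding Pxy_def using meas[of "(\<lambda>f. (f, y)) ` part Q j"] y part_sub[OF j] by auto
    also have "\<dots> = w y j"
      unfolding w_def by (subst sum.reindex) (auto simp: inj_on_def)
    finally show ?thesis .
  qed
  have simple: "simple_function M h" for h :: "'f \<times> nat \<Rightarrow> 'z"
    unfolding M_eq using fin by simp
  have "mutual_information 2 (count_space (X ` space M)) (count_space (Y ` space M)) X Y =
      (\<Sum>(x, y)\<in>(\<lambda>x. (X x, Y x)) ` space M. Pxy (x, y) * log 2 (Pxy (x, y) / (Px x * Py y)))"
    by (intro mutual_information_simple_distributed simple_distributedI simple)
      (auto simp: Px_def Py_def Pxy_def)
  moreover have "mutual_info Q n \<psi> W =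
      mutual_information 2 (count_space (X ` space M)) (count_space (Y ` space M)) X Y"
    unfolding X_space Y_space unfolding mutual_info_def M_def X_def Y_def N_def ..
  ultimately have "mutual_info Q n \<psi> W =
      (\<Sum>j\<in>labels Q. \<Sum>y<N. Pxy (j, y) * log 2 (Pxy (j, y) / (Px j * Py y)))"
    by (simp add: XY_space sum.cartesian_product)
  also have "\<dots> = (\<Sum>j\<in>labels Q. \<Sum>y<N. w y j * log 2 (w y j / sum (w y) (labels Q)) -
      w y j * log 2 (label_prob Q j))"
  proof (intro sum.cong refl)
    fix j y assume j: "j \<in> labels Q" and "y \<in> {..<N}"
    then have y: "y < N" by simp
    have w: "0 \<le> w y i" if "i \<in> labels Q" for i
      unfolding w_def using D_nonneg part_sub[OF that] y by (intro sum_nonneg) auto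
    have "w y j * log 2 (w y j / (label_prob Q j * sum (w y) (labels Q))) =
      w y j * log 2 (w y j / sum (w y) (labels Q)) - w y j * log 2 (label_prob Q j)"
    \<comment> \<open>A positive joint probability forces a positive outcome probability, so the
      logarithm of the quotient can be split.\<close>
    proof (cases "w y j = 0")
      case False
      then have "0 < w y j" using w[OF j] by simp
      moreover have "w y j \<le> sum (w y) (labels Q)"
        using w j Q'(4) by (intro member_le_sum) auto
      ultimately have "0 < w y j / sum (w y) (labels Q)" by simp
      then have "log 2 (w y j / sum (w y) (labels Q) / label_prob Q j) =
          log 2 (w y j / sum (w y) (labels Q)) - log 2 (label_prob Q j)"
        using Q'(10)[OF j] by (intro log_divide_pos) auto
      moreover have "w y j / (label_prob Q j * sum (w y) (labels Q)) =
          w y j / sum (w y) (labels Q) / label_prob Q j"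
        by (simp add: mult.commute)
      ultimately show ?thesis by (simp only: right_diff_distrib)
    qed simp
    then show "Pxy (j, y) * log 2 (Pxy (j, y) / (Px j * Py y)) =
      w y j * log 2 (w y j / sum (w y) (labels Q)) - w y j * log 2 (label_prob Q j)"
      using j y by (simp add: Px Py Pxy)
  qed
  also have "\<dots> = (\<Sum>y<N. \<Sum>j\<in>labels Q. w y j * log 2 (w y j / sum (w y) (labels Q))) -
      (\<Sum>j\<in>labels Q. (\<Sum>y<N. w y j) * log 2 (label_prob Q j))"
    by (simp add: sum_subtractf sum_distrib_right sum.swap[of _ "labels Q"])
  also have "(\<Sum>y<N. \<Sum>j\<in>labels Q. w y j * log 2 (w y j / sum (w y) (labels Q))) =
      - (\<Sum>y<N. weighted_entropy (labels Q) (w y))"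
    by (simp add: weighted_entropy_def sum_negf)
  also have "(\<Sum>y<N. weighted_entropy (labels Q) (w y)) = (\<Sum>y<N. weighted_entropy (labels Q)
      (class_weight Q n \<psi> (mat_adjoint W * ketbra (unit_vec N y) * W)))"
    unfolding weighted_entropy_def w_def D_def N_def
    using class_weight_basis_projection[OF W] by simp
  \<comment> \<open>Summing out the outcome gives the label prior, hence the term H(J).\<close>
  also have "(\<Sum>j\<in>labels Q. (\<Sum>y<N. w y j) * log 2 (label_prob Q j)) =
      (\<Sum>j\<in>labels Q. label_prob Q j * log 2 (label_prob Q j))"
  proof (intro sum.cong refl)
    fix j assume j: "j \<in> labels Q"
    have "(\<Sum>y<N. w y j) = (\<Sum>f\<in>part Q j. \<Sum>y<N. D (f, y))"
      unfolding w_def by (rule sum.swap)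
    also have "\<dots> = label_prob Q j"
      unfolding label_prob_def using rowsum part_sub[OF j] by (intro sum.cong) auto
    finally show "(\<Sum>y<N. w y j) * log 2 (label_prob Q j) = label_prob Q j * log 2 (label_prob Q j)"
      by simp
  qed
  finally show ?thesis by (simp add: N_def)
qed

lemma class_weight_basis_nonneg:
  assumes "unitary_mat (2 ^ n) W" "y < 2 ^ n" "j \<in> labels Q"
  shows "0 \<le> class_weight Q n \<psi> (mat_adjoint W * ketbra (unit_vec (2 ^ n) y) * W) j"
  using class_weight_nonneg[OF Q n \<psi>
      projective_measurementD(1-3)[OF basis_measurement_projective[OF assms(1)]] assms(3)] assms(2)
  by (simp add: basis_measurement_nth)

text \<open>The bound H(J) does not depend on W. It makes the set of attainable values bounded
  above, which the real supremum in \<open>I_max\<close> requires to be an upper bound.\<close>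

lemma mutual_info_le:
  assumes "unitary_mat (2 ^ n) W"
  shows "mutual_info Q n \<psi> W \<le> - (\<Sum>j\<in>labels Q. label_prob Q j * log 2 (label_prob Q j))"
proof -
  have "0 \<le> (\<Sum>y<2 ^ n. weighted_entropy (labels Q)
      (class_weight Q n \<psi> (mat_adjoint W * ketbra (unit_vec (2 ^ n) y) * W)))"
    using oracle_classification_problemD(4)[OF Q] class_weight_basis_nonneg[OF assms]
    by (intro sum_nonneg weighted_entropy_nonneg) auto
  then show ?thesis unfolding mutual_info_eq[OF assms] by simp
qed

lemma mutual_info_le_I_max:
  assumes "unitary_mat (2 ^ n) W"
  shows "mutual_info Q n \<psi> W \<le> I_max Q n \<psi>"
proof -
  have "bdd_above (mutual_info Q n \<psi> ` {W. unitary_mat (2 ^ n) W})"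
    using mutual_info_le by (intro bdd_aboveI2) auto
  then show ?thesis
    unfolding I_max_def using assms by (intro cSUP_upper) auto
qed

lemma discord_basis_measurement:
  assumes ket: "label_basis Q ket" and W: "unitary_mat (2 ^ n) W"
  defines "R \<equiv> rho_JY Q ket n \<psi>" and "d \<equiv> card (labels Q)"
  shows "discord_Y d (2 ^ n) R (basis_measurement n W) =
    vn_entropy (trace_out_J d (2 ^ n) R) - vn_entropy R -
    (\<Sum>j\<in>labels Q. label_prob Q j * log 2 (label_prob Q j)) - mutual_info Q n \<psi> W"
  unfolding mutual_info_eq[OF W] R_def d_def
    discord_Y_eq[OF Q n \<psi> ket basis_measurement_projective[OF W]]
  by (simp add: basis_measurement_nth)

text \<open>Outcome k of the given measurement splits into the basis vectors with
  \<open>\<kappa> i = k\<close>. Weights add within each group, so superadditivity compares the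
  entropies group by group.\<close>

lemma discord_refine:
  assumes ket: "label_basis Q ket" and Ps: "projective_measurement (2 ^ n) Ps"
  defines "R \<equiv> rho_JY Q ket n \<psi>" and "d \<equiv> card (labels Q)"
  obtains W where "unitary_mat (2 ^ n) W"
    "discord_Y d (2 ^ n) R (basis_measurement n W) \<le> discord_Y d (2 ^ n) R Ps"
proof -
  obtain W \<kappa> where W: "unitary_mat (2 ^ n) W" and \<kappa>: "\<forall>i<2 ^ n. \<kappa> i < length Ps"
    and dec: "\<forall>k<length Ps. Ps ! k =
      mat_sum (2 ^ n) (\<lambda>i. mat_adjoint W * ketbra (unit_vec (2 ^ n) i) * W) {i \<in> {..<2 ^ n}. \<kappa> i = k}"
    using projective_measurement_refine[OF Ps] by blast
  define E where "E = (\<lambda>i. mat_adjoint W * ketbra (unit_vec (2 ^ n) i) * W)"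
  let ?w = "\<lambda>P. class_weight Q n \<psi> P"
  have E: "E i \<in> carrier_mat (2 ^ n) (2 ^ n)" for i
    using unitary_matD(1)[OF W] unfolding E_def by (intro mult_carrier_mat[of _ _ "2 ^ n"]) auto
  have "(\<Sum>i<2 ^ n. weighted_entropy (labels Q) (?w (E i))) =
      (\<Sum>k<length Ps. \<Sum>i\<in>{i \<in> {..<2 ^ n}. \<kappa> i = k}. weighted_entropy (labels Q) (?w (E i)))"
    \<comment> \<open>A group may be empty; this happens exactly for zero projections in the
      list.\<close>
    using \<kappa> by (intro sum.group[symmetric]) auto
  also have "\<dots> \<le> (\<Sum>k<length Ps. weighted_entropy (labels Q) (?w (Ps ! k)))"
  proof (rule sum_mono)
    fix k assume "k \<in> {..<length Ps}"
    then have k: "Ps ! k = mat_sum (2 ^ n) E {i \<in> {..<2 ^ n}. \<kappa> i = k}"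
      using dec by (simp add: E_def)
    have "(\<Sum>i\<in>{i \<in> {..<2 ^ n}. \<kappa> i = k}. weighted_entropy (labels Q) (?w (E i))) \<le>
        weighted_entropy (labels Q) (\<lambda>j. \<Sum>i\<in>{i \<in> {..<2 ^ n}. \<kappa> i = k}. ?w (E i) j)"
      using oracle_classification_problemD(4)[OF Q] class_weight_basis_nonneg[OF W]
      by (intro weighted_entropy_superadditive) (auto simp: E_def)
    also have "\<dots> = weighted_entropy (labels Q) (?w (Ps ! k))"
      unfolding weighted_entropy_def k by (simp add: class_weight_mat_sum[OF Q n \<psi> E])
    finally show "(\<Sum>i\<in>{i \<in> {..<2 ^ n}. \<kappa> i = k}. weighted_entropy (labels Q) (?w (E i))) \<le>
        weighted_entropy (labels Q) (?w (Ps ! k))" .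
  qed
  finally have "discord_Y d (2 ^ n) R (basis_measurement n W) \<le> discord_Y d (2 ^ n) R Ps"
    unfolding R_def d_def discord_Y_eq[OF Q n \<psi> ket Ps]
      discord_Y_eq[OF Q n \<psi> ket basis_measurement_projective[OF W]]
    by (simp add: basis_measurement_nth E_def)
  with W show ?thesis by (rule that)
qed

text \<open>Minimality over all projective measurements reduces to minimality over basis
  measurements: these are projective, and each projective measurement is matched or beaten by one of
  them. Among basis measurements, discord plus mutual information is constant.\<close>

lemma is_arg_min_discord_iff:
  assumes ket: "label_basis Q ket" and W: "unitary_mat (2 ^ n) W"
  shows "is_arg_min (discord_Y (card (labels Q)) (2 ^ n) (rho_JY Q ket n \<psi>))
      (projective_measurement (2 ^ n)) (basis_measurement n W) \<longleftrightarrow>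
    (\<forall>W'. unitary_mat (2 ^ n) W' \<longrightarrow> mutual_info Q n \<psi> W' \<le> mutual_info Q n \<psi> W)"
proof -
  let ?D = "discord_Y (card (labels Q)) (2 ^ n) (rho_JY Q ket n \<psi>)"
  have "(\<forall>Ps. projective_measurement (2 ^ n) Ps \<longrightarrow> ?D (basis_measurement n W) \<le> ?D Ps) \<longleftrightarrow>
    (\<forall>W'. unitary_mat (2 ^ n) W' \<longrightarrow> ?D (basis_measurement n W) \<le> ?D (basis_measurement n W'))"
  proof safe
    fix Ps assume *: "\<forall>W'. unitary_mat (2 ^ n) W' \<longrightarrow> ?D (basis_measurement n W) \<le> ?D (basis_measurement n W')"
      and Ps: "projective_measurement (2 ^ n) Ps"
    obtain W' where "unitary_mat (2 ^ n) W'" "?D (basis_measurement n W') \<le> ?D Ps"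
      using discord_refine[OF ket Ps] .
    with * show "?D (basis_measurement n W) \<le> ?D Ps" by (meson order_trans)
  qed (use basis_measurement_projective in blast)
  then show ?thesis
    using basis_measurement_projective[OF W]
    by (auto simp: is_arg_min_linorder discord_basis_measurement[OF ket] W)
qed

end

theorem mainTheorem1:
  fixes Q :: "('f, 'j) oracle_problem"
    and ket :: "'j \<Rightarrow> complex vec"
    and n :: nat
    and \<psi>0 :: "complex vec"
    and V W :: "complex mat"
  assumes "oracle_classification_problem Q"
    and "label_basis Q ket"
    and "qubits Q \<le> n"
    and "normalized (2 ^ n) \<psi>0"
    and "unitary_mat (2 ^ n) V"
    and "unitary_mat (2 ^ n) W"
  shows "is_arg_max (\<lambda>(V', W'). mutual_info Q n (V' *\<^sub>v \<psi>0) W')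
           (\<lambda>(V', W'). unitary_mat (2 ^ n) V' \<and> unitary_mat (2 ^ n) W') (V, W)
     \<longleftrightarrow>
       is_arg_max (I_max Q n) (normalized (2 ^ n)) (V *\<^sub>v \<psi>0)
     \<and> is_arg_min (discord_Y (card (labels Q)) (2 ^ n) (rho_JY Q ket n (V *\<^sub>v \<psi>0)))
         (projective_measurement (2 ^ n)) (basis_measurement n W)"
proof -
  note Q = assms(1) and n = assms(3)
  let ?U = "unitary_mat (2 ^ n)" and ?I = "mutual_info Q n"
  have norm: "normalized (2 ^ n) (V' *\<^sub>v \<psi>0)" if "?U V'" for V'
    using that assms(4) by (rule unitary_mat_normalized)
  note V\<psi> = norm[OF assms(5)]
  have max_iff: "is_arg_max (\<lambda>(V', W'). ?I (V' *\<^sub>v \<psi>0) W') (\<lambda>(V', W'). ?U V' \<and> ?U W') (V, W) \<longleftrightarrow>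
      (\<forall>V' W'. ?U V' \<longrightarrow> ?U W' \<longrightarrow> ?I (V' *\<^sub>v \<psi>0) W' \<le> ?I (V *\<^sub>v \<psi>0) W)"
    using assms(5,6) by (auto simp: is_arg_max_linorder)
  have unit_iff: "normalized (2 ^ n) \<psi> \<longleftrightarrow> (\<exists>V'. ?U V' \<and> V' *\<^sub>v \<psi>0 = \<psi>)" for \<psi>
    using norm unitary_mat_transitive[OF assms(4)] by (metis zero_less_numeral zero_less_power)
  have "is_arg_max (I_max Q n) (normalized (2 ^ n)) (V *\<^sub>v \<psi>0) \<longleftrightarrow>
      (\<forall>V'. ?U V' \<longrightarrow> I_max Q n (V' *\<^sub>v \<psi>0) \<le> I_max Q n (V *\<^sub>v \<psi>0))"
    using V\<psi> unit_iff by (auto simp: is_arg_max_linorder)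
  moreover note is_arg_min_discord_iff[OF Q n V\<psi> assms(2,6)]
  moreover note max_iff
  \<comment> \<open>The least-upper-bound property needs a nonempty index set, which
    \<open>W\<close> provides.\<close>
  moreover have "I_max Q n (V' *\<^sub>v \<psi>0) \<le> B" if "?U V'" "\<And>W'. ?U W' \<Longrightarrow> ?I (V' *\<^sub>v \<psi>0) W' \<le> B" for V' B
    unfolding I_max_def using that assms(6) by (intro cSUP_least) auto
  moreover note mutual_info_le_I_max[OF Q n norm]
  \<comment> \<open>If (V, W) is optimal, then each \<open>I_max Q n (V' *\<^sub>v \<psi>0)\<close>
    is at most the value at (V, W), hence at most \<open>I_max Q n (V *\<^sub>v \<psi>0)\<close>;
    the case V' = V gives (2). Conversely, (2) makes the value at (V, W) equal to
    \<open>I_max Q n (V *\<^sub>v \<psi>0)\<close>, which by (1) dominates \<open>I_max\<close> at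
    every V' and so every value at (V', W').\<close>
  ultimately show ?thesis
    using assms(5,6) by (smt (verit, best) order_trans)
qed

end
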